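(* Any dendron is the sampling limit of a convergent sequence of finite trees: for every dendron $D$ there exists a sequence $(T_n)_{n\in\mathbb{N}}$ of nontrivial finite trees such that, for all positive integers $r$, the sampling measures $\tau_r(T_n)$ weakly converge to $\tau_r(D)$ in $\mathrm{Prob}(M_r)$.
   Context: $\mathbb{N}$ is the set of positive integers. A finite (graph-theoretic) tree is identified with its vertex set and is nontrivial if it has at least two vertices. For a nontrivial finite tree $T$ with shortest path metric $\overline{d}_T$, the normalized distance is $d_T(x,y)=\overline{d}_T(x,y)/\mathrm{diam}_{\overline{d}_T}(T)$, and $\mu_T$ is the uniform probability measure on $T$. Sampling measures. For $r\ge1$, $M_r$ is the space of real $r\times r$ matrices, identified with $\prod_{1\le i,j\le r}\mathbb{R}$; $\mathrm{Prob}(M_r)$ is the space of Borel probability measures on $M_r$. For a set $X$ and $d:X^2\to\mathbb{R}$, define $\rho_r^{X,d}:X^r\to M_r$ by $\rho_r^{X,d}(x_1,\dots,x_r)=(d_{ij})$, with $d_{ij}=d(x_i,x_j)$ for $i\ne j$ and $d_{ii}=0$. For a triple $(X,d,\mu)$ with $\mu$ a probability measure on $X$ and $d$ a $\mu^2$-measurable function, $\tau_r(X,d,\mu)\in\mathrm{Prob}(M_r)$ is the push-forward of $\mu^r$ along $\rho_r^{X,d}$. For a nontrivial finite tree, $\tau_r(T)=\tau_r(T,d_T,\mu_T)$. A sequence of finite trees $(T_n)$ is convergent in metric sampling if for every $r\ge1$ the measures $\tau_r(T_n)$ converge weakly in $\mathrm{Prob}(M_r)$; $D$ is its sampling limit if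 $\tau_r(T_n)$ converges weakly to $\tau_r(D)$ for all $r$. Real trees. A real tree is a non-empty complete metric space $(T,d)$ such that for any two distinct points $p,q\in T$ there is an isometric embedding $\alpha:[a,b]\to T$ of an interval with $\alpha(a)=p$, $\alpha(b)=q$ and such that for every $a<c<b$ the points $p$ and $q$ are in distinct connected components of $T\setminus\{\alpha(c)\}$. For $p\in T$ the connected components of $T\setminus\{p\}$ are the $p$-branches; a branch of $T$ is a $p$-branch for some $p\in T$. Dendrons. A long dendron $D=(T,d,\nu)$ is a real tree $(T,d)$ together with a Borel probability measure $\nu$ on $A_D=T\times[0,\infty)$ (product topology) satisfying $\nu(B\times[0,\infty))>0$ for all branches $B$ of $T$. Define $d_D:A_D^2\to\mathbb{R}$ by $d_D((u,a),(v,b))=d(u,v)+a+b$. A long dendron $D$ is a dendron if $\nu^2(\{(x,y)\in A_D^2\mid d_D(x,y)>1\})=0$. For a long dendron, $\tau_r(D)=\tau_r(A_D,d_D,\nu)$. *)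

theory Defs
  imports "HOL-Probability.Probability" "Graph_Theory.Pair_Digraph" "Graph_Theory.Digraph_Component"
begin

definition borel_of :: "'x topology \<Rightarrow> 'x measure" where
  "borel_of X = sigma (topspace X) {U. openin X U}"

definition Prob :: "'x topology \<Rightarrow> 'x measure set" where
  "Prob X = {M. prob_space M \<and> sets M = sets (borel_of X)}"

definition weakly_converges ::
    "'x topology \<Rightarrow> (nat \<Rightarrow> 'x measure) \<Rightarrow> 'x measure \<Rightarrow> bool" where
  "weakly_converges X Ms M \<longleftrightarrow>
     range Ms \<subseteq> Prob X \<and> M \<in> Prob X \<and>
     (\<forall>f. continuous_map X euclideanreal f \<and> bounded (f ` topspace X) \<longrightarrow>
        (\<lambda>n. \<integral>A. f A \<partial>Ms n) \<longlonglongrightarrow> (\<integral>A. f A \<partial>M))"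

text \<open>The size of the matrices is a variable, so a real \<open>r \<times> r\<close> matrix is an extensional function
  on the index set \<open>{1..r} \<times> {1..r}\<close>.\<close>

definition matrix_space :: "nat \<Rightarrow> (nat \<times> nat \<Rightarrow> real) topology" where
  "matrix_space r = product_topology (\<lambda>_. euclideanreal) ({1..r} \<times> {1..r})"

definition distance_matrix ::
    "nat \<Rightarrow> ('x \<Rightarrow> 'x \<Rightarrow> real) \<Rightarrow> (nat \<Rightarrow> 'x) \<Rightarrow> (nat \<times> nat \<Rightarrow> real)" where
  "distance_matrix r d x =
     (\<lambda>(i, j) \<in> {1..r} \<times> {1..r}. if i = j then 0 else d (x i) (x j))"

definition sampling_measure ::
    "nat \<Rightarrow> ('x \<Rightarrow> 'x \<Rightarrow> real) \<Rightarrow> 'x measure \<Rightarrow> (nat \<times> nat \<Rightarrow> real) measure" where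
  "sampling_measure r d \<mu> =
     distr (\<Pi>\<^sub>M i\<in>{1..r}. \<mu>) (borel_of (matrix_space r)) (distance_matrix r d)"

text \<open>A finite simple graph is a finite loopless digraph with a symmetric set of arcs. An edge
  traversed back and forth is a directed cycle of length 2, so acyclicity only concerns cycles of
  length at least 3; for the same reason the predicate \<open>tree\<close> of the library, which forbids all
  directed cycles, does not describe undirected trees in this encoding.\<close>

definition finite_tree :: "'v pair_pre_digraph \<Rightarrow> bool" where
  "finite_tree G \<longleftrightarrow>
     pair_graph G \<and> Digraph_Component.connected (with_proj G) \<and>
     \<not> (\<exists>c. pre_digraph.cycle (with_proj G) c \<and> 3 \<le> length c)"

definition nontrivial_finite_tree :: "'v pair_pre_digraph \<Rightarrow> bool" where
  "nontrivial_finite_tree G \<longleftrightarrow> finite_tree G \<and> 2 \<le> card (pverts G)"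

definition graph_dist :: "'v pair_pre_digraph \<Rightarrow> 'v \<Rightarrow> 'v \<Rightarrow> nat" where
  "graph_dist G x y = (LEAST k. \<exists>p. pre_digraph.awalk (with_proj G) x p y \<and> length p = k)"

definition graph_diam :: "'v pair_pre_digraph \<Rightarrow> nat" where
  "graph_diam G = Max {graph_dist G x y | x y. x \<in> pverts G \<and> y \<in> pverts G}"

definition tree_dist :: "'v pair_pre_digraph \<Rightarrow> 'v \<Rightarrow> 'v \<Rightarrow> real" where
  "tree_dist G x y = real (graph_dist G x y) / real (graph_diam G)"

definition tree_sampling_measure ::
    "nat \<Rightarrow> 'v pair_pre_digraph \<Rightarrow> (nat \<times> nat \<Rightarrow> real) measure" where
  "tree_sampling_measure r G =
     sampling_measure r (tree_dist G) (uniform_count_measure (pverts G))"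

definition convergent_in_metric_sampling :: "(nat \<Rightarrow> 'v pair_pre_digraph) \<Rightarrow> bool" where
  "convergent_in_metric_sampling Ts \<longleftrightarrow>
     (\<forall>r\<ge>1. \<exists>M. weakly_converges (matrix_space r) (\<lambda>n. tree_sampling_measure r (Ts n)) M)"

definition punctured :: "'a metric \<Rightarrow> 'a \<Rightarrow> 'a topology" where
  "punctured T p = subtopology (mtopology_of T) (mspace T - {p})"

definition real_tree :: "'a metric \<Rightarrow> bool" where
  "real_tree T \<longleftrightarrow>
     mspace T \<noteq> {} \<and> mcomplete_of T \<and>
     (\<forall>p\<in>mspace T. \<forall>q\<in>mspace T. p \<noteq> q \<longrightarrow>
        (\<exists>(a::real) b \<alpha>. a \<le> b \<and> \<alpha> \<in> {a..b} \<rightarrow> mspace T \<and>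
           (\<forall>s\<in>{a..b}. \<forall>t\<in>{a..b}. mdist T (\<alpha> s) (\<alpha> t) = \<bar>s - t\<bar>) \<and>
           \<alpha> a = p \<and> \<alpha> b = q \<and>
           (\<forall>c. a < c \<and> c < b \<longrightarrow>
              connected_component_of_set (punctured T (\<alpha> c)) p \<noteq>
              connected_component_of_set (punctured T (\<alpha> c)) q)))"

definition branch :: "'a metric \<Rightarrow> 'a set \<Rightarrow> bool" where
  "branch T B \<longleftrightarrow> (\<exists>p\<in>mspace T. B \<in> connected_components_of (punctured T p))"

definition dendron_space :: "'a metric \<Rightarrow> ('a \<times> real) topology" where
  "dendron_space T = prod_topology (mtopology_of T) (top_of_set {0..})"

definition long_dendron :: "'a metric \<Rightarrow> ('a \<times> real) measure \<Rightarrow> bool" where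
  "long_dendron T \<nu> \<longleftrightarrow>
     real_tree T \<and> \<nu> \<in> Prob (dendron_space T) \<and>
     (\<forall>B. branch T B \<longrightarrow> 0 < emeasure \<nu> (B \<times> {0..}))"

text \<open>This is not a metric: the distance of \<open>(u, a)\<close> from itself is \<open>2 * a\<close>.\<close>

definition dendron_dist :: "'a metric \<Rightarrow> 'a \<times> real \<Rightarrow> 'a \<times> real \<Rightarrow> real" where
  "dendron_dist T = (\<lambda>(u, a) (v, b). mdist T u v + a + b)"

definition dendron :: "'a metric \<Rightarrow> ('a \<times> real) measure \<Rightarrow> bool" where
  "dendron T \<nu> \<longleftrightarrow>
     long_dendron T \<nu> \<and>
     emeasure (\<nu> \<Otimes>\<^sub>M \<nu>) {(x, y). x \<in> mspace T \<times> {0..} \<and> y \<in> mspace T \<times> {0..} \<and>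
       dendron_dist T x y > 1} = 0"

definition dendron_sampling_measure ::
    "nat \<Rightarrow> 'a metric \<Rightarrow> ('a \<times> real) measure \<Rightarrow> (nat \<times> nat \<Rightarrow> real) measure" where
  "dendron_sampling_measure r T \<nu> = sampling_measure r (dendron_dist T) \<nu>"

end

theory Submission
  imports Defs
begin

text \<open>
  Far apart points at similar distances from a root lie in disjoint branches, which have positive
  measure; so the real tree is separable. Hence, for every \<open>\<epsilon> > 0\<close>, all of \<open>A\<^sub>D\<close> except for a set of measure \<open>\<epsilon>\<close> is covered by
  finitely many disjoint pieces of positive measure, each within \<open>\<epsilon>\<close> of a representative
  \<open>(u\<^sub>l, a\<^sub>l)\<close>; since \<open>d\<^sub>D \<le> 1\<close> almost surely, the representatives have mutual distances at most
  \<open>1 + 4 * \<epsilon>\<close>. By 0-hyperbolicity, the integer parts of the Gromov products of the \<open>u\<^sub>l\<close>, scaled by a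
  large \<open>N\<close>, satisfy the ultrametric inequality and therefore describe a rooted graph-theoretic tree
  with almost the right distances, in which every \<open>u\<^sub>l\<close> is extended by \<open>m\<close> separate paths of length
  about \<open>N * a\<^sub>l\<close>. Attaching to the ends of these paths a huge number of leaves, proportional to the
  measure of the piece, makes a uniformly random vertex almost always a leaf of the right piece.
  Two samples from the same piece mostly lie on different paths if \<open>m\<close> is large, which accounts for
  \<open>d\<^sub>D(x, x) = 2 * a\<close> at an atom \<open>x = (u, a)\<close>. One more path of suitable length makes the diameter
  nearly \<open>N\<close>. All matrices lie in a cube, on which the test functions are uniformly continuous.
\<close>

section \<open>Sampling measures\<close>

text \<open>In a general metric space the distance need not be measurable for the product
  \<sigma>-algebra, and small balls around countably many points need not cover. Here it is the
  positivity of \<open>\<nu>\<close> on branches that excludes this, so separability has to be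
  extracted from the measure before the sampling measures can be handled. The two sampling measures
  live over unrelated spaces; they are compared through a finite set of labels with a kernel
  \<open>D\<close>. Replacing points by their labels changes distances only a little outside a small
  set of pairs, both in the dendron and in the tree, and the two laws of the label nearly agree. In
  general \<open>D k k > 0\<close>, so the kernel is not a metric. The extra path is there because
  the normalization divides by the diameter, whereas nothing forces \<open>d_D\<close> to come close
  to 1 on the support of \<open>\<nu>\<close>. The estimates depend on a test function only through
  a bound and a modulus of continuity, and one tree serves all \<open>r \<le> n\<close>; hence a
  single sequence suffices for all sizes of matrices.\<close>

lemma space_borel_of [simp]: "space (borel_of X) = topspace X"
  unfolding borel_of_def by (rule space_measure_of) (auto dest: openin_subset)

lemma sets_borel_of: "sets (borel_of X) = sigma_sets (topspace X) {U. openin X U}"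
  unfolding borel_of_def by (rule sets_measure_of) (auto dest: openin_subset)

lemma openin_sets_borel_of: "openin X U \<Longrightarrow> U \<in> sets (borel_of X)"
  by (simp add: sets_borel_of sigma_sets.Basic)

lemma continuous_map_borel_measurable:
  assumes "continuous_map X euclideanreal f"
  shows "f \<in> borel_measurable (borel_of X)"
proof (rule borel_measurableI)
  fix S :: "real set" assume "open S"
  then have "openin X {x \<in> topspace X. f x \<in> S}"
    using assms by (auto simp: continuous_map_def)
  then show "f -` S \<inter> space (borel_of X) \<in> sets (borel_of X)"
    by (auto intro!: openin_sets_borel_of simp: Collect_conj_eq vimage_def Int_commute)
qed

lemma continuous_map_restrict_product:
  "continuous_map euclidean (product_topology (\<lambda>_. euclideanreal) I) (\<lambda>A. restrict A I)"
proof -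
  have "continuous_on UNIV (\<lambda>A :: 'a \<Rightarrow> real. A k)" for k
    by (rule continuous_on_product_coordinates)
  then show ?thesis
    by (auto simp: continuous_map_componentwise)
qed

lemma restrict_measurable_matrix_space:
  "(\<lambda>A. restrict A ({1..r} \<times> {1..r})) \<in> borel \<rightarrow>\<^sub>M borel_of (matrix_space r)"
  unfolding borel_of_def
proof (rule measurable_measure_of)
  show "{U. openin (matrix_space r) U} \<subseteq> Pow (topspace (matrix_space r))"
    by (auto dest: openin_subset)
  show "(\<lambda>A. restrict A ({1..r} \<times> {1..r})) \<in> space borel \<rightarrow> topspace (matrix_space r)"
    by (auto simp: matrix_space_def)
next
  fix U assume "U \<in> {U. openin (matrix_space r) U}"
  then have "openin euclidean {A \<in> topspace euclidean. restrict A ({1..r} \<times> {1..r}) \<in> U}"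
    using continuous_map_restrict_product[of "{1..r} \<times> {1..r}"]
    unfolding continuous_map_def matrix_space_def by blast
  then show "(\<lambda>A. restrict A ({1..r} \<times> {1..r})) -` U \<inter> space borel \<in> sets borel"
    by (auto simp: vimage_def intro: borel_open)
qed

text \<open>Extended by 0 to all index pairs, matrices become elements of a function type, whose
  topology and metric come from type classes; \<open>restrict\<close> is continuous and carries the
  results back to \<open>matrix_space\<close>.\<close>

definition total_matrix :: "nat \<Rightarrow> ('x \<Rightarrow> 'x \<Rightarrow> real) \<Rightarrow> (nat \<Rightarrow> 'x) \<Rightarrow> (nat \<times> nat \<Rightarrow> real)" where
  "total_matrix r d x =
     (\<lambda>(i, j). if i \<in> {1..r} \<and> j \<in> {1..r} \<and> i \<noteq> j then d (x i) (x j) else 0)"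

lemma distance_matrix_eq_restrict:
  "distance_matrix r d x = restrict (total_matrix r d x) ({1..r} \<times> {1..r})"
  by (auto simp: distance_matrix_def total_matrix_def restrict_def)

lemma distance_matrix_measurable:
  assumes d: "case_prod d \<in> borel_measurable (M \<Otimes>\<^sub>M M)"
  shows "distance_matrix r d \<in> (\<Pi>\<^sub>M i\<in>{1..r}. M) \<rightarrow>\<^sub>M borel_of (matrix_space r)"
proof -
  have "(\<lambda>x. total_matrix r d x k) \<in> borel_measurable (\<Pi>\<^sub>M i\<in>{1..r}. M)" for k
  proof (cases k)
    case (Pair i j)
    show ?thesis
    proof (cases "i \<in> {1..r} \<and> j \<in> {1..r} \<and> i \<noteq> j")
      case True
      then have "(\<lambda>x. (x i, x j)) \<in> (\<Pi>\<^sub>M i\<in>{1..r}. M) \<rightarrow>\<^sub>M M \<Otimes>\<^sub>M M"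
        by (intro measurable_Pair measurable_component_singleton) auto
      from measurable_compose[OF this d] show ?thesis
        using True Pair by (simp add: total_matrix_def)
    next
      case False
      then have "(\<lambda>x. total_matrix r d x k) = (\<lambda>_. 0)" using Pair by (auto simp: total_matrix_def)
      then show ?thesis by simp
    qed
  qed
  then have "total_matrix r d \<in> borel_measurable (\<Pi>\<^sub>M i\<in>{1..r}. M)"
    by (rule measurable_coordinatewise_then_product)
  from measurable_compose[OF this restrict_measurable_matrix_space] show ?thesis
    by (simp add: distance_matrix_eq_restrict[abs_def])
qed

lemma prob_space_PiM_const: "prob_space M \<Longrightarrow> prob_space (\<Pi>\<^sub>M i\<in>I. M)"
  by (rule prob_space_PiM)

lemma sampling_measure_in_Prob:
  assumes "prob_space M" "case_prod d \<in> borel_measurable (M \<Otimes>\<^sub>M M)"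
  shows "sampling_measure r d M \<in> Prob (matrix_space r)"
  unfolding Prob_def sampling_measure_def
  using prob_space.prob_space_distr[OF prob_space_PiM_const[OF assms(1)] distance_matrix_measurable[OF assms(2)]]
  by simp

lemma integral_sampling_measure:
  assumes "case_prod d \<in> borel_measurable (M \<Otimes>\<^sub>M M)" "continuous_map (matrix_space r) euclideanreal f"
  shows "(\<integral>A. f A \<partial>sampling_measure r d M) = (\<integral>x. f (distance_matrix r d x) \<partial>(\<Pi>\<^sub>M i\<in>{1..r}. M))"
  unfolding sampling_measure_def
  by (rule integral_distr[OF distance_matrix_measurable[OF assms(1)] continuous_map_borel_measurable[OF assms(2)]])

text \<open>Two distinct coordinates of an independent sample form an independent pair. This turns a
  small set of bad pairs into a small event for each off-diagonal entry; diagonal entries are 0 by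
  definition and need no such control.\<close>

lemma distr_PiM_pair:
  assumes M: "prob_space M" and ij: "i \<in> I" "j \<in> I" "i \<noteq> j"
  shows "distr (\<Pi>\<^sub>M i\<in>I. M) (M \<Otimes>\<^sub>M M) (\<lambda>x. (x i, x j)) = M \<Otimes>\<^sub>M M"
proof (rule sym, rule pair_measure_eqI)
  interpret M: prob_space M by fact
  interpret P: product_prob_space "\<lambda>_. M" I by unfold_locales
  show "sigma_finite_measure M" "sigma_finite_measure M" by unfold_locales
  fix A B assume AB: "A \<in> sets M" "B \<in> sets M"
  have "emeasure (distr (\<Pi>\<^sub>M i\<in>I. M) (M \<Otimes>\<^sub>M M) (\<lambda>x. (x i, x j))) (A \<times> B)
      = emeasure (\<Pi>\<^sub>M i\<in>I. M) ((\<lambda>x. (x i, x j)) -` (A \<times> B) \<inter> space (\<Pi>\<^sub>M i\<in>I. M))"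
    using AB ij by (intro emeasure_distr) auto
  also have "(\<lambda>x. (x i, x j)) -` (A \<times> B) \<inter> space (\<Pi>\<^sub>M i\<in>I. M)
      = {x \<in> space (\<Pi>\<^sub>M i\<in>I. M). \<forall>k\<in>{i, j}. x k \<in> (if k = i then A else B)}"
    using ij by auto
  also have "emeasure (\<Pi>\<^sub>M i\<in>I. M) \<dots> = (\<Prod>k\<in>{i, j}. emeasure M (if k = i then A else B))"
    using AB ij by (intro P.emeasure_PiM_Collect) auto
  also have "\<dots> = emeasure M A * emeasure M B" using ij by auto
  finally show "emeasure M A * emeasure M B
      = emeasure (distr (\<Pi>\<^sub>M i\<in>I. M) (M \<Otimes>\<^sub>M M) (\<lambda>x. (x i, x j))) (A \<times> B)" by simp
qed simp

section \<open>Moduli of continuity of test functions on a cube of matrices\<close>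

definition matrix_modulus :: "nat \<Rightarrow> ((nat \<times> nat \<Rightarrow> real) \<Rightarrow> real) \<Rightarrow> real \<Rightarrow> real \<Rightarrow> real \<Rightarrow> bool" where
  "matrix_modulus r f C \<delta> \<eta> \<longleftrightarrow>
     (\<forall>a b. (\<forall>k. a k \<in> {0..C} \<and> b k \<in> {0..C} \<and> \<bar>a k - b k\<bar> \<le> \<delta>) \<longrightarrow>
        \<bar>f (restrict a ({1..r} \<times> {1..r})) - f (restrict b ({1..r} \<times> {1..r}))\<bar> \<le> \<eta>)"

text \<open>The distance of functions is a series with weights \<open>(1/2)^n\<close>, whose sum is
  2, and every summand is at most \<open>\<delta>\<close> times its weight.\<close>

lemma dist_fun_le_uniform:
  fixes a b :: "'i :: countable \<Rightarrow> real"
  assumes "\<And>k. \<bar>a k - b k\<bar> \<le> \<delta>"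
  shows "dist a b \<le> 2 * \<delta>"
proof -
  have \<delta>: "0 \<le> \<delta>" using assms[of undefined] by linarith
  have g: "summable (\<lambda>n. (1/2::real)^n)" by (rule summable_geometric) simp
  have le: "(1/2)^n * min (dist (a (from_nat n)) (b (from_nat n))) 1 \<le> (1/2)^n * \<delta>" for n
    using assms[of "from_nat n"] by (intro mult_left_mono) (auto simp: dist_real_def min_def)
  have "summable (\<lambda>n. (1/2)^n * min (dist (a (from_nat n)) (b (from_nat n))) 1)"
    by (rule summable_comparison_test'[of "\<lambda>n. (1/2)^n * \<delta>" 0])
      (use le g \<delta> in \<open>auto intro!: summable_mult2 simp: abs_mult\<close>)
  then have "dist a b \<le> (\<Sum>n. (1/2)^n * \<delta>)"
    unfolding dist_fun_def by (intro suminf_le le summable_mult2 g)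
  also have "\<dots> = 2 * \<delta>"
    by (subst suminf_mult2[OF g, symmetric]) (simp add: suminf_geometric)
  finally show ?thesis .
qed

text \<open>Boundedness of \<open>f\<close> gives no uniform continuity, compactness of the cube
  does: by Tychonoff the cube over all index pairs is compact, and \<open>f\<close> is pulled back
  to it along \<open>restrict\<close>. The choice \<open>e / 3\<close> absorbs the factor 2 between
  uniform distance and \<open>dist\<close>.\<close>

lemma continuous_imp_matrix_modulus:
  assumes f: "continuous_map (matrix_space r) euclideanreal f" and "\<eta> > 0"
  obtains \<delta> where "\<delta> > 0" "matrix_modulus r f C \<delta> \<eta>"
proof -
  define K :: "(nat \<times> nat \<Rightarrow> real) set" where "K = PiE UNIV (\<lambda>_. {0..C})"
  define F where "F a = f (restrict a ({1..r} \<times> {1..r}))" for a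
  have "compactin (product_topology (\<lambda>_. euclideanreal) UNIV) K"
    unfolding K_def compactin_PiE by (auto simp: compactin_euclidean_iff)
  then have "compact K" by (simp add: euclidean_product_topology compactin_euclidean_iff)
  moreover have "continuous_map euclidean euclideanreal F"
    unfolding F_def
    using continuous_map_compose[OF continuous_map_restrict_product f[unfolded matrix_space_def]]
    by (simp add: o_def)
  then have "continuous_on K F" by (auto intro: continuous_on_subset)
  ultimately have "uniformly_continuous_on K F" by (intro compact_uniformly_continuous)
  then obtain e where e: "e > 0" "\<And>a b. a \<in> K \<Longrightarrow> b \<in> K \<Longrightarrow> dist b a < e \<Longrightarrow> dist (F b) (F a) < \<eta>"
    using \<open>\<eta> > 0\<close> unfolding uniformly_continuous_on_def by metis
  show thesis
  proof
    show "e / 3 > 0" using e by simp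
    show "matrix_modulus r f C (e / 3) \<eta>"
      unfolding matrix_modulus_def
    proof (intro allI impI)
      fix a b :: "nat \<times> nat \<Rightarrow> real"
      assume ab: "\<forall>k. a k \<in> {0..C} \<and> b k \<in> {0..C} \<and> \<bar>a k - b k\<bar> \<le> e / 3"
      then have "dist a b \<le> 2 * (e / 3)" by (intro dist_fun_le_uniform) auto
      then have "dist a b < e" using e by simp
      then have "dist (F a) (F b) < \<eta>" using ab by (intro e) (auto simp: K_def)
      then show "\<bar>f (restrict a ({1..r} \<times> {1..r})) - f (restrict b ({1..r} \<times> {1..r}))\<bar> \<le> \<eta>"
        by (simp add: F_def dist_real_def)
    qed
  qed
qed

lemma distance_matrix_in_topspace: "distance_matrix r d x \<in> topspace (matrix_space r)"
  by (auto simp: matrix_space_def distance_matrix_def)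

text \<open>Union bound: except on an event of probability at most \<open>r^2 * \<epsilon>\<close>,
  no pair of sample points falls into \<open>S\<close>; then all entries move by at most
  \<open>\<delta>\<close> and \<open>f\<close> by at most \<open>\<eta>\<close>. On the exceptional
  event \<open>f\<close> moves by at most \<open>2 * B\<close>.\<close>

lemma sampling_measure_close:
  assumes M: "prob_space M"
    and d: "case_prod d \<in> borel_measurable (M \<Otimes>\<^sub>M M)" "case_prod d' \<in> borel_measurable (M \<Otimes>\<^sub>M M)"
    and f: "continuous_map (matrix_space r) euclideanreal f" "\<And>A. A \<in> topspace (matrix_space r) \<Longrightarrow> \<bar>f A\<bar> \<le> B"
    and mod: "matrix_modulus r f C \<delta> \<eta>" and C: "0 \<le> C" "0 \<le> \<delta>" "0 \<le> \<eta>"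
    and S: "S \<in> sets (M \<Otimes>\<^sub>M M)" "measure (M \<Otimes>\<^sub>M M) S \<le> \<epsilon>"
    and good: "\<And>x y. x \<in> space M \<Longrightarrow> y \<in> space M \<Longrightarrow> (x, y) \<notin> S \<Longrightarrow>
      d x y \<in> {0..C} \<and> d' x y \<in> {0..C} \<and> \<bar>d x y - d' x y\<bar> \<le> \<delta>"
  shows "\<bar>(\<integral>A. f A \<partial>sampling_measure r d M) - (\<integral>A. f A \<partial>sampling_measure r d' M)\<bar>
    \<le> \<eta> + 2 * B * real r ^ 2 * \<epsilon>"
proof -
  let ?P = "\<Pi>\<^sub>M i\<in>{1..r}. M"
  interpret M: prob_space M by fact
  interpret P: prob_space ?P by (rule prob_space_PiM_const) fact
  define I where "I = {(i, j). i \<in> {1..r} \<and> j \<in> {1..r} \<and> i \<noteq> j}"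
  have I: "I \<subseteq> {1..r} \<times> {1..r}" by (auto simp: I_def)
  then have fI: "finite I" by (rule finite_subset) simp
  have cI: "card I \<le> r ^ 2"
    using card_mono[OF _ I] by (simp add: card_cartesian_product power2_eq_square)
  define E where "E k = (\<lambda>x. (x (fst k), x (snd k))) -` S \<inter> space ?P" for k :: "nat \<times> nat"
  have meas: "(\<lambda>x. (x (fst k), x (snd k))) \<in> ?P \<rightarrow>\<^sub>M M \<Otimes>\<^sub>M M" if "k \<in> I" for k
    using that by (intro measurable_Pair measurable_component_singleton) (auto simp: I_def)
  have E: "E k \<in> sets ?P" if "k \<in> I" for k
    unfolding E_def by (rule measurable_sets[OF meas[OF that] S(1)])
  have PE: "measure ?P (E k) \<le> \<epsilon>" if "k \<in> I" for k
  proof -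
    have "measure ?P (E k) = measure (distr ?P (M \<Otimes>\<^sub>M M) (\<lambda>x. (x (fst k), x (snd k)))) S"
      unfolding E_def by (rule measure_distr[symmetric, OF meas[OF that] S(1)])
    also have "\<dots> = measure (M \<Otimes>\<^sub>M M) S"
      using that by (subst distr_PiM_pair[OF M]) (auto simp: I_def)
    finally show ?thesis using S by simp
  qed
  define U where "U = (\<Union>k\<in>I. E k)"
  have U: "U \<in> sets ?P" unfolding U_def using E fI by auto
  have \<epsilon>0: "0 \<le> \<epsilon>" using S(2) measure_nonneg order_trans by blast
  have PU: "measure ?P U \<le> real r ^ 2 * \<epsilon>"
  proof -
    have "measure ?P U \<le> (\<Sum>k\<in>I. measure ?P (E k))"
      unfolding U_def using E fI by (intro P.finite_measure_subadditive_finite) auto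
    also have "\<dots> \<le> (\<Sum>k\<in>I. \<epsilon>)" by (intro sum_mono PE)
    also have "\<dots> \<le> real (r ^ 2) * \<epsilon>"
      using cI \<epsilon>0 by (simp add: mult_right_mono del: of_nat_power)
    finally show ?thesis by simp
  qed
  let ?g = "\<lambda>x. f (distance_matrix r d x)" and ?g' = "\<lambda>x. f (distance_matrix r d' x)"
  have B: "0 \<le> B" using f(2)[OF distance_matrix_in_topspace] by (meson abs_ge_zero order_trans)
  have m: "?g \<in> borel_measurable ?P" "?g' \<in> borel_measurable ?P"
    by (rule measurable_compose[OF distance_matrix_measurable continuous_map_borel_measurable[OF f(1)]], rule d)+
  have bd: "\<bar>f (distance_matrix r d x)\<bar> \<le> B" for d :: "'a \<Rightarrow> 'a \<Rightarrow> real" and x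
    by (intro f distance_matrix_in_topspace)
  have int: "integrable ?P ?g" "integrable ?P ?g'"
    by (rule P.integrable_const_bound[where B = B]; use m bd in simp)+
  have pt: "\<bar>?g x - ?g' x\<bar> \<le> \<eta> + 2 * B * indicator U x" if x: "x \<in> space ?P" for x
  proof (cases "x \<in> U")
    case True
    then show ?thesis using bd[of d x] bd[of d' x] C by (simp add: abs_if split: if_splits)
  next
    case False
    have *: "d (x i) (x j) \<in> {0..C} \<and> d' (x i) (x j) \<in> {0..C} \<and> \<bar>d (x i) (x j) - d' (x i) (x j)\<bar> \<le> \<delta>"
      if "i \<in> {1..r}" "j \<in> {1..r}" "i \<noteq> j" for i j
    proof (rule good)
      show "x i \<in> space M" "x j \<in> space M" using x that by (auto simp: space_PiM)
      have "(i, j) \<in> I" using that by (auto simp: I_def)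
      then show "(x i, x j) \<notin> S" using False x unfolding U_def E_def by force
    qed
    have "\<bar>?g x - ?g' x\<bar> \<le> \<eta>"
      unfolding distance_matrix_eq_restrict
      using mod[unfolded matrix_modulus_def, rule_format, of "total_matrix r d x" "total_matrix r d' x"]
        * C by (auto simp: total_matrix_def)
    then show ?thesis using False by simp
  qed
  have indU: "integrable ?P (indicator U :: _ \<Rightarrow> real)"
    using U P.emeasure_finite[of U, unfolded less_top] by (intro integrable_real_indicator) (simp_all only: infinity_ennreal_def)
  then have intU: "integrable ?P (\<lambda>x. \<eta> + 2 * B * indicator U x)"
    by (intro Bochner_Integration.integrable_add P.integrable_const Bochner_Integration.integrable_mult_right)
  have "\<bar>(\<integral>x. ?g x \<partial>?P) - (\<integral>x. ?g' x \<partial>?P)\<bar> = \<bar>\<integral>x. ?g x - ?g' x \<partial>?P\<bar>"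
    using int by simp
  also have "\<dots> \<le> (\<integral>x. \<bar>?g x - ?g' x\<bar> \<partial>?P)" by (rule integral_abs_bound)
  also have "\<dots> \<le> (\<integral>x. \<eta> + 2 * B * indicator U x \<partial>?P)"
  proof (rule integral_mono)
    show "integrable ?P (\<lambda>x. \<bar>?g x - ?g' x\<bar>)" using int by simp
    show "integrable ?P (\<lambda>x. \<eta> + 2 * B * indicator U x)" by (rule intU)
  qed (rule pt)
  also have "\<dots> = \<eta> + 2 * B * measure ?P U"
    unfolding Bochner_Integration.integral_add[OF P.integrable_const Bochner_Integration.integrable_mult_right[OF indU]]
    using U by (simp add: P.prob_space del: One_nat_def)
  also have "\<dots> \<le> \<eta> + 2 * B * (real r ^ 2 * \<epsilon>)"
    using PU B by (intro add_left_mono mult_left_mono) auto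
  finally show ?thesis
    using d f by (simp add: integral_sampling_measure mult.assoc)
qed

section \<open>Samples seen through finitely many labels\<close>

lemma measurable_pushforward_dist:
  assumes s: "s \<in> M \<rightarrow>\<^sub>M count_space I" and I: "finite I"
  shows "case_prod (\<lambda>x y. dI (s x) (s y) :: real) \<in> borel_measurable (M \<Otimes>\<^sub>M M)"
proof -
  have "(\<lambda>(x, y). (s x, s y)) \<in> M \<Otimes>\<^sub>M M \<rightarrow>\<^sub>M count_space I \<Otimes>\<^sub>M count_space I"
    using s by measurable
  moreover have "count_space I \<Otimes>\<^sub>M count_space I = count_space (I \<times> I)"
    by (rule pair_measure_count_space) (use I in auto)
  ultimately have "(\<lambda>(x, y). (s x, s y)) \<in> M \<Otimes>\<^sub>M M \<rightarrow>\<^sub>M count_space (I \<times> I)" by simp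
  from measurable_compose[OF this, of "case_prod dI"] show ?thesis
    by (simp add: split_beta)
qed

text \<open>The labels of independent samples are independent, so the integral is a finite sum over
  words of \<open>r\<close> labels. \<open>M\<close> enters only through the weights of the labels,
  which makes measures on different spaces comparable.\<close>

lemma integral_sampling_measure_finite:
  assumes M: "prob_space M" and s: "s \<in> M \<rightarrow>\<^sub>M count_space I" and I: "finite I"
    and f: "continuous_map (matrix_space r) euclideanreal f"
  shows "(\<integral>A. f A \<partial>sampling_measure r (\<lambda>x y. dI (s x) (s y)) M)
    = (\<Sum>l\<in>{1..r} \<rightarrow>\<^sub>E I. (\<Prod>j\<in>{1..r}. measure M (s -` {l j} \<inter> space M)) * f (distance_matrix r dI l))"
proof -
  let ?P = "\<Pi>\<^sub>M i\<in>{1..r}. M"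
  interpret M: prob_space M by fact
  interpret P: finite_product_prob_space "\<lambda>_. M" "{1..r}" by unfold_locales simp
  define Q where "Q l = ({1..r} \<rightarrow>\<^sub>E (s -` {l} \<inter> space M))" for l
  define box where "box l = (\<Pi>\<^sub>E j\<in>{1..r}. s -` {l j} \<inter> space M)" for l :: "nat \<Rightarrow> 'b"
  have fin: "finite ({1..r} \<rightarrow>\<^sub>E I)" using I by (intro finite_PiE) auto
  have sets: "s -` {l j} \<inter> space M \<in> sets M" if "l \<in> {1..r} \<rightarrow>\<^sub>E I" "j \<in> {1..r}" for l j
    using that by (intro measurable_sets[OF s]) (auto simp: PiE_iff)
  have box: "box l \<in> sets ?P" if "l \<in> {1..r} \<rightarrow>\<^sub>E I" for l
    unfolding box_def using sets[OF that] by (intro sets_PiM_I_finite) auto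
  have eq: "f (distance_matrix r (\<lambda>x y. dI (s x) (s y)) x)
     = (\<Sum>l\<in>{1..r} \<rightarrow>\<^sub>E I. indicator (box l) x * f (distance_matrix r dI l))" if x: "x \<in> space ?P" for x
  proof -
    define l0 where "l0 = restrict (\<lambda>j. s (x j)) {1..r}"
    have xM: "x j \<in> space M" if "j \<in> {1..r}" for j using x that by (auto simp: space_PiM)
    have l0: "l0 \<in> {1..r} \<rightarrow>\<^sub>E I"
      using measurable_space[OF s xM] by (auto simp: l0_def)
    \<comment> \<open>The boxes partition the sample space by words of labels, so only the word
      \<open>l0\<close> of \<open>x\<close> contributes.\<close>
    have ind: "indicator (box l) x = (if l = l0 then 1 else 0 :: real)" if "l \<in> {1..r} \<rightarrow>\<^sub>E I" for l
    proof -
      have "x \<in> box l \<longleftrightarrow> (\<forall>j\<in>{1..r}. s (x j) = l j)"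
        using x by (auto simp: box_def space_PiM PiE_iff)
      also have "\<dots> \<longleftrightarrow> l = l0"
        using that l0 by (auto simp: l0_def PiE_iff extensional_def fun_eq_iff)
      finally show ?thesis by (simp add: indicator_def)
    qed
    have "(\<Sum>l\<in>{1..r} \<rightarrow>\<^sub>E I. indicator (box l) x * f (distance_matrix r dI l))
       = (\<Sum>l\<in>{1..r} \<rightarrow>\<^sub>E I. if l = l0 then f (distance_matrix r dI l) else 0)"
      by (intro sum.cong) (auto simp: ind)
    also have "\<dots> = f (distance_matrix r dI l0)" using l0 fin by simp
    also have "distance_matrix r dI l0 = distance_matrix r (\<lambda>x y. dI (s x) (s y)) x"
      by (auto simp: distance_matrix_def l0_def fun_eq_iff)
    finally show ?thesis by simp
  qed
  have intb: "integrable ?P (\<lambda>x. indicator (box l) x * f (distance_matrix r dI l))"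
    if "l \<in> {1..r} \<rightarrow>\<^sub>E I" for l
    using box[OF that] P.emeasure_finite[of "box l", unfolded less_top]
    by (intro integrable_mult_left integrable_real_indicator) (simp_all only: infinity_ennreal_def)
  have "(\<integral>A. f A \<partial>sampling_measure r (\<lambda>x y. dI (s x) (s y)) M)
     = (\<integral>x. f (distance_matrix r (\<lambda>x y. dI (s x) (s y)) x) \<partial>?P)"
    by (rule integral_sampling_measure[OF measurable_pushforward_dist[OF s I] f])
  also have "\<dots> = (\<integral>x. (\<Sum>l\<in>{1..r} \<rightarrow>\<^sub>E I. indicator (box l) x * f (distance_matrix r dI l)) \<partial>?P)"
    by (intro Bochner_Integration.integral_cong eq) auto
  also have "\<dots> = (\<Sum>l\<in>{1..r} \<rightarrow>\<^sub>E I. \<integral>x. indicator (box l) x * f (distance_matrix r dI l) \<partial>?P)"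
    by (intro Bochner_Integration.integral_sum intb)
  also have "\<dots> = (\<Sum>l\<in>{1..r} \<rightarrow>\<^sub>E I. measure ?P (box l) * f (distance_matrix r dI l))"
    using box by (intro sum.cong) auto
  also have "\<dots> = (\<Sum>l\<in>{1..r} \<rightarrow>\<^sub>E I. (\<Prod>j\<in>{1..r}. measure M (s -` {l j} \<inter> space M)) * f (distance_matrix r dI l))"
    unfolding box_def by (intro sum.cong refl arg_cong2[where f = "(*)"] P.prob_times sets)
  finally show ?thesis .
qed

text \<open>Products of numbers in \<open>[0,1]\<close> differ by at most the sum of the differences
  of their factors, and there are \<open>card I ^ r\<close> words. This large factor is harmless, as
  \<open>\<delta>\<close> will be chosen after \<open>I\<close>.\<close>

lemma sampling_measure_finite_close:
  assumes M: "prob_space M" and M': "prob_space M'"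
    and s: "s \<in> M \<rightarrow>\<^sub>M count_space I" and t: "t \<in> M' \<rightarrow>\<^sub>M count_space I" and I: "finite I"
    and f: "continuous_map (matrix_space r) euclideanreal f" "\<And>A. A \<in> topspace (matrix_space r) \<Longrightarrow> \<bar>f A\<bar> \<le> B"
    and st: "\<And>l. l \<in> I \<Longrightarrow> \<bar>measure M (s -` {l} \<inter> space M) - measure M' (t -` {l} \<inter> space M')\<bar> \<le> \<delta>"
  shows "\<bar>(\<integral>A. f A \<partial>sampling_measure r (\<lambda>x y. dI (s x) (s y)) M)
      - (\<integral>A. f A \<partial>sampling_measure r (\<lambda>x y. dI (t x) (t y)) M')\<bar>
    \<le> B * real (card I) ^ r * (real r * \<delta>)"
proof -
  interpret M: prob_space M by fact
  interpret M': prob_space M' by fact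
  define w where "w l = measure M (s -` {l} \<inter> space M)" for l
  define v where "v l = measure M' (t -` {l} \<inter> space M')" for l
  let ?L = "{1..r} \<rightarrow>\<^sub>E I"
  have B: "0 \<le> B" using f(2)[OF distance_matrix_in_topspace] by (meson abs_ge_zero order_trans)
  have prod: "\<bar>(\<Prod>j\<in>{1..r}. w (l j)) - (\<Prod>j\<in>{1..r}. v (l j))\<bar> \<le> real r * \<delta>" if l: "l \<in> ?L" for l
  proof -
    have "norm ((\<Prod>j\<in>{1..r}. w (l j)) - (\<Prod>j\<in>{1..r}. v (l j))) \<le> (\<Sum>j\<in>{1..r}. norm (w (l j) - v (l j)))"
      by (intro norm_prod_diff) (auto simp: w_def v_def)
    also have "\<dots> \<le> (\<Sum>j\<in>{1..r}. \<delta>)"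
      using l st by (intro sum_mono) (auto simp: w_def v_def PiE_iff)
    finally show ?thesis by simp
  qed
  have "\<bar>(\<integral>A. f A \<partial>sampling_measure r (\<lambda>x y. dI (s x) (s y)) M)
      - (\<integral>A. f A \<partial>sampling_measure r (\<lambda>x y. dI (t x) (t y)) M')\<bar>
      = \<bar>\<Sum>l\<in>?L. ((\<Prod>j\<in>{1..r}. w (l j)) - (\<Prod>j\<in>{1..r}. v (l j))) * f (distance_matrix r dI l)\<bar>"
    unfolding integral_sampling_measure_finite[OF M s I f(1)] integral_sampling_measure_finite[OF M' t I f(1)]
      w_def v_def by (simp add: sum_subtractf left_diff_distrib)
  also have "\<dots> \<le> (\<Sum>l\<in>?L. \<bar>(\<Prod>j\<in>{1..r}. w (l j)) - (\<Prod>j\<in>{1..r}. v (l j))\<bar> * \<bar>f (distance_matrix r dI l)\<bar>)"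
    unfolding abs_mult[symmetric] by (rule sum_abs)
  also have "\<dots> \<le> (\<Sum>l\<in>?L. (real r * \<delta>) * B)"
    using prod f(2)[OF distance_matrix_in_topspace]
    by (intro sum_mono mult_mono) (auto intro: order_trans[OF abs_ge_zero])
  also have "\<dots> = B * real (card I) ^ r * (real r * \<delta>)"
    by (simp add: card_PiE)
  finally show ?thesis .
qed

section \<open>Geometry of real trees\<close>

text \<open>For each \<open>n\<close> only finitely many disjoint sets can have measure above
  \<open>1 / (n + 1)\<close> in a finite measure space.\<close>

lemma countable_if_disjoint_positive_measure:
  assumes M: "finite_measure M" and disj: "disjoint_family_on A I"
    and pos: "\<And>i. i \<in> I \<Longrightarrow> 0 < emeasure M (A i)"
  shows "countable I"
proof -
  interpret finite_measure M by fact
  \<comment> \<open>Non-measurable sets get \<open>emeasure\<close> 0, so positivity yields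
    measurability.\<close>
  have A: "A i \<in> sets M" if "i \<in> I" for i
    using pos[OF that] emeasure_notin_sets by force
  define F where "F n = {i \<in> I. 1 / real (Suc n) < measure M (A i)}" for n
  have fin: "finite (F n)" for n
  proof (rule ccontr)
    assume inf: "infinite (F n)"
    obtain N where N: "real (Suc n) * measure M (space M) < real N" using reals_Archimedean2 by blast
    obtain K where K: "K \<subseteq> F n" "finite K" "card K = N"
      using infinite_arbitrarily_large[OF inf] by blast
    have "real N * (1 / real (Suc n)) = (\<Sum>i\<in>K. 1 / real (Suc n))" using K by simp
    also have "\<dots> \<le> (\<Sum>i\<in>K. measure M (A i))"
      using K by (intro sum_mono) (auto simp: F_def)
    also have "\<dots> = measure M (\<Union>i\<in>K. A i)"
      using K A disjoint_family_on_mono[OF _ disj, of K]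
      by (intro finite_measure_finite_Union[symmetric]) (auto simp: F_def)
    also have "\<dots> \<le> measure M (space M)" by (rule bounded_measure)
    finally show False using N by (simp add: field_simps)
  qed
  have "I \<subseteq> (\<Union>n. F n)"
  proof
    fix i assume i: "i \<in> I"
    then have "0 < measure M (A i)" using pos[OF i] by (simp add: emeasure_eq_measure)
    then obtain n where "1 / real (Suc n) < measure M (A i)"
      using reals_Archimedean by (metis inverse_eq_divide)
    then show "i \<in> (\<Union>n. F n)" using i by (auto simp: F_def)
  qed
  moreover have "countable (\<Union>n. F n)" by (intro countable_UN countableI_type countable_finite fin)
  ultimately show ?thesis by (rule countable_subset)
qed

section \<open>Geodesics and segments of a real tree\<close>

locale real_tree_space =
  fixes T :: "'a metric"
  assumes real_tree: "real_tree T"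
begin

abbreviation "X \<equiv> mspace T"
abbreviation "d \<equiv> mdist T"

sublocale Metric_space X d by (rule Metric_space_mspace_mdist)

lemma topology: "mtopology_of T = mtopology" by (simp add: mtopology_of_def)

text \<open>Equality in the triangle inequality describes the segment symmetrically and without a
  choice of geodesic; \<open>segment_properties\<close> identifies it with the image of one.\<close>

definition segment :: "'a \<Rightarrow> 'a \<Rightarrow> 'a set" where
  "segment x y = {c \<in> X. d x c + d c y = d x y}"

definition geodesic :: "'a \<Rightarrow> 'a \<Rightarrow> (real \<Rightarrow> 'a) \<Rightarrow> bool" where
  "geodesic x y \<alpha> \<longleftrightarrow> \<alpha> \<in> {0..d x y} \<rightarrow> X \<and> \<alpha> 0 = x \<and> \<alpha> (d x y) = y \<and>
     (\<forall>s\<in>{0..d x y}. \<forall>t\<in>{0..d x y}. d (\<alpha> s) (\<alpha> t) = \<bar>s - t\<bar>)"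

lemma geodesicD:
  assumes "geodesic x y \<alpha>"
  shows geodesic_start: "\<alpha> 0 = x" and geodesic_end: "\<alpha> (d x y) = y"
    and geodesic_dist: "\<And>s t. 0 \<le> s \<Longrightarrow> s \<le> d x y \<Longrightarrow> 0 \<le> t \<Longrightarrow> t \<le> d x y \<Longrightarrow> d (\<alpha> s) (\<alpha> t) = \<bar>s - t\<bar>"
  using assms unfolding geodesic_def by simp_all

lemma geodesic_image_ends:
  assumes "geodesic x y \<alpha>"
  shows "x \<in> \<alpha> ` {0..d x y}" "y \<in> \<alpha> ` {0..d x y}"
  using geodesicD[OF assms] by (auto intro: rev_image_eqI[of 0] rev_image_eqI[of "d x y"])

text \<open>The separation axiom in a positive form: a connected set that contains both ends but
  misses an interior point of the geodesic would put both ends into one component of the punctured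
  space.\<close>

lemma ex_geodesic:
  assumes x: "x \<in> X" and y: "y \<in> X"
  obtains \<alpha> where "geodesic x y \<alpha>"
    "\<And>C t. connectedin mtopology C \<Longrightarrow> x \<in> C \<Longrightarrow> y \<in> C \<Longrightarrow> t \<in> {0..d x y} \<Longrightarrow> \<alpha> t \<in> C"
proof (cases "x = y")
  case True
  then show thesis using x by (intro that[of "\<lambda>_. x"]) (auto simp: geodesic_def)
next
  case False
  then obtain a b :: real and \<alpha> where ab: "a \<le> b" "\<alpha> \<in> {a..b} \<rightarrow> X"
    and iso: "\<And>s t. s \<in> {a..b} \<Longrightarrow> t \<in> {a..b} \<Longrightarrow> d (\<alpha> s) (\<alpha> t) = \<bar>s - t\<bar>"
    and ends: "\<alpha> a = x" "\<alpha> b = y"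
    and sep: "\<And>c. a < c \<Longrightarrow> c < b \<Longrightarrow> connected_component_of_set (punctured T (\<alpha> c)) x \<noteq>
              connected_component_of_set (punctured T (\<alpha> c)) y"
    using real_tree x y unfolding real_tree_def by metis
  have D: "d x y = b - a" using iso[of a b] ab ends by simp
  show thesis
  proof (rule that[of "\<lambda>t. \<alpha> (a + t)"])
    show "geodesic x y (\<lambda>t. \<alpha> (a + t))"
      using ab iso ends D by (auto simp: geodesic_def)
  next
    fix C t assume C: "connectedin mtopology C" "x \<in> C" "y \<in> C" and t: "t \<in> {0..d x y}"
    show "\<alpha> (a + t) \<in> C"
    proof (rule ccontr)
      assume n: "\<alpha> (a + t) \<notin> C"
      \<comment> \<open>The axiom speaks of interior points only; the ends lie in \<open>C\<close>
        by assumption.\<close>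
      have "a + t \<noteq> a" using n C(2) ends(1) by metis
      moreover have "a + t \<noteq> b" using n C(3) ends(2) by metis
      ultimately have in_ab: "a < a + t" "a + t < b" using t D by auto
      have "C \<subseteq> X" using C(1) connectedin_subset_topspace by fastforce
      then have "connectedin (punctured T (\<alpha> (a + t))) C"
        using C n unfolding punctured_def topology by (auto simp: connectedin_subtopology)
      then have "connected_component_of (punctured T (\<alpha> (a + t))) x y"
        using C unfolding connected_component_of_def by blast
      then have "connected_component_of_set (punctured T (\<alpha> (a + t))) x =
          connected_component_of_set (punctured T (\<alpha> (a + t))) y"
        by (simp add: connected_component_of_equiv)
      then show False using sep[OF in_ab] by simp
    qed
  qed
qed

lemma geodesic_exists:
  assumes "x \<in> X" "y \<in> X"
  shows "\<exists>\<alpha>. geodesic x y \<alpha>"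
  by (rule ex_geodesic[OF assms]) (rule exI)

lemma connectedin_geodesic:
  assumes "geodesic x y \<alpha>"
  shows "connectedin mtopology (\<alpha> ` {0..d x y})"
proof -
  have "continuous_map (top_of_set {0..d x y}) mtopology \<alpha>"
    unfolding continuous_map_to_metric
  proof (intro ballI allI impI)
    fix s \<epsilon> :: real assume s: "s \<in> topspace (top_of_set {0..d x y})" and "\<epsilon> > 0"
    then show "\<exists>U. openin (top_of_set {0..d x y}) U \<and> s \<in> U \<and> (\<forall>t\<in>U. \<alpha> t \<in> mball (\<alpha> s) \<epsilon>)"
      using assms
      by (intro exI[of _ "{0..d x y} \<inter> ball s \<epsilon>"])
        (auto simp: geodesic_def openin_open_Int dist_real_def Pi_iff)
  qed
  moreover have "connectedin (top_of_set {0..d x y}) {0..d x y}"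
    by (simp add: connectedin_subtopology)
  ultimately show ?thesis by (rule connectedin_continuous_map_image)
qed

lemma geodesic_subset_segment:
  assumes "x \<in> X" "y \<in> X" "geodesic x y \<alpha>"
  shows "\<alpha> ` {0..d x y} \<subseteq> segment x y"
proof
  fix c assume "c \<in> \<alpha> ` {0..d x y}"
  then obtain t where t: "t \<in> {0..d x y}" "c = \<alpha> t" by blast
  have "d x c = t" "d c y = d x y - t"
    using geodesic_dist[OF assms(3), of 0 t] geodesic_dist[OF assms(3), of t "d x y"]
      geodesic_start[OF assms(3)] geodesic_end[OF assms(3)] t by simp_all
  moreover have "c \<in> X" using t assms(3) by (auto simp: geodesic_def)
  ultimately show "c \<in> segment x y" by (simp add: segment_def)
qed

text \<open>Everything reduces to segment = image of the geodesic \<open>\<alpha>\<close>. For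
  \<open>c\<close> in the segment, geodesics from \<open>x\<close> to \<open>c\<close> and from
  \<open>c\<close> to \<open>y\<close> have a connected union, which must contain the point of
  \<open>\<alpha>\<close> at distance \<open>d x c\<close> from \<open>x\<close>. On the first half
  the distance to \<open>x\<close>, on the second half the distance to \<open>y\<close>, forces that
  point to be \<open>c\<close>.\<close>

lemma segment_properties:
  assumes x: "x \<in> X" and y: "y \<in> X"
  shows connectedin_segment: "connectedin mtopology (segment x y)"
    and segment_subset_connected:
      "\<And>C. connectedin mtopology C \<Longrightarrow> x \<in> C \<Longrightarrow> y \<in> C \<Longrightarrow> segment x y \<subseteq> C"
    and segment_point: "\<And>t. 0 \<le> t \<Longrightarrow> t \<le> d x y \<Longrightarrow> \<exists>c\<in>segment x y. d x c = t"
    and dist_in_segment: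
      "\<And>c c'. c \<in> segment x y \<Longrightarrow> c' \<in> segment x y \<Longrightarrow> d c c' = \<bar>d x c - d x c'\<bar>"
proof -
  obtain \<alpha> where \<alpha>: "geodesic x y \<alpha>"
    and sep: "\<And>C t. connectedin mtopology C \<Longrightarrow> x \<in> C \<Longrightarrow> y \<in> C \<Longrightarrow> t \<in> {0..d x y} \<Longrightarrow> \<alpha> t \<in> C"
    using ex_geodesic[OF x y] by blast
  note iso = geodesic_dist[OF \<alpha>] and ends = geodesic_start[OF \<alpha>] geodesic_end[OF \<alpha>]
  have point: "\<alpha> (d x c) = c" if c: "c \<in> segment x y" for c
  proof -
    have cX: "c \<in> X" and eq: "d x c + d c y = d x y" using c by (simp_all add: segment_def)
    have in_D: "0 \<le> d x c" "d x c \<le> d x y" using eq nonneg[of c y] nonneg[of x c] by linarith+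
    obtain \<beta> where \<beta>: "geodesic x c \<beta>" using geodesic_exists[OF x cX] by (rule exE)
    obtain \<gamma> where \<gamma>: "geodesic c y \<gamma>" using geodesic_exists[OF cX y] by (rule exE)
    have "connectedin mtopology (\<beta> ` {0..d x c} \<union> \<gamma> ` {0..d c y})"
    proof (rule connectedin_Un[OF connectedin_geodesic[OF \<beta>] connectedin_geodesic[OF \<gamma>]])
      show "\<beta> ` {0..d x c} \<inter> \<gamma> ` {0..d c y} \<noteq> {}"
        using IntI[OF geodesic_image_ends(2)[OF \<beta>] geodesic_image_ends(1)[OF \<gamma>]] by (metis empty_iff)
    qed
    then have "\<alpha> (d x c) \<in> \<beta> ` {0..d x c} \<union> \<gamma> ` {0..d c y}"
      using in_D
      by (intro sep UnI1[OF geodesic_image_ends(1)[OF \<beta>]] UnI2[OF geodesic_image_ends(2)[OF \<gamma>]])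
        simp_all
    then show ?thesis
    proof
      assume "\<alpha> (d x c) \<in> \<beta> ` {0..d x c}"
      then obtain t where t: "0 \<le> t" "t \<le> d x c" "\<alpha> (d x c) = \<beta> t" by auto
      have "d x (\<beta> t) = t"
        using geodesic_dist[OF \<beta>, of 0 t] t geodesic_start[OF \<beta>] by simp
      moreover have "d x (\<alpha> (d x c)) = d x c" using iso[of 0 "d x c"] in_D ends by simp
      ultimately show ?thesis using t geodesic_end[OF \<beta>] by simp
    next
      assume "\<alpha> (d x c) \<in> \<gamma> ` {0..d c y}"
      then obtain t where t: "0 \<le> t" "t \<le> d c y" "\<alpha> (d x c) = \<gamma> t" by auto
      have "d (\<gamma> t) y = d c y - t"
        using geodesic_dist[OF \<gamma>, of t "d c y"] t geodesic_end[OF \<gamma>] by simp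
      moreover have "d (\<alpha> (d x c)) y = d x y - d x c" using iso[of "d x c" "d x y"] in_D ends by simp
      ultimately have "t = 0" using t(3) eq by simp
      then show ?thesis using t(3) geodesic_start[OF \<gamma>] by simp
    qed
  qed
  have rng: "d x c \<in> {0..d x y}" if "c \<in> segment x y" for c
  proof -
    have "d x c + d c y = d x y" using that by (simp add: segment_def)
    then have "d x c \<le> d x y" using nonneg[of c y] by linarith
    then show ?thesis by simp
  qed
  have img: "segment x y = \<alpha> ` {0..d x y}"
  proof
    show "segment x y \<subseteq> \<alpha> ` {0..d x y}" using point rng by (metis image_eqI subsetI)
  qed (rule geodesic_subset_segment[OF x y \<alpha>])
  show "connectedin mtopology (segment x y)" using connectedin_geodesic[OF \<alpha>] img by simp
  show "segment x y \<subseteq> C" if "connectedin mtopology C" "x \<in> C" "y \<in> C" for C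
    using sep[OF that] img by auto
  show "\<exists>c\<in>segment x y. d x c = t" if "0 \<le> t" "t \<le> d x y" for t
    using that iso[of 0 t] ends img by (intro bexI[of _ "\<alpha> t"]) auto
  show "d c c' = \<bar>d x c - d x c'\<bar>" if "c \<in> segment x y" "c' \<in> segment x y" for c c'
    using iso[of "d x c" "d x c'"] rng[OF that(1)] rng[OF that(2)] point that by simp
qed

lemma segment_ends: "x \<in> X \<Longrightarrow> y \<in> X \<Longrightarrow> x \<in> segment x y \<and> y \<in> segment x y"
  by (auto simp: segment_def)

text \<open>Triangles are 0-thin: two sides form a connected set that contains the ends of the
  third.\<close>

lemma segment_subset_Un:
  assumes "x \<in> X" "y \<in> X" "z \<in> X"
  shows "segment x y \<subseteq> segment x z \<union> segment z y"
proof (rule segment_subset_connected)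
  show "connectedin mtopology (segment x z \<union> segment z y)"
    using assms segment_ends[of x z] segment_ends[of z y] by (intro connectedin_Un connectedin_segment) blast+
qed (use assms segment_ends in auto)

section \<open>Gromov products and the four-point condition\<close>

definition gromov_product :: "'a \<Rightarrow> 'a \<Rightarrow> 'a \<Rightarrow> real" where
  "gromov_product x y z = (d x y + d x z - d y z) / 2"

lemma gromov_product_bounds:
  assumes "x \<in> X" "y \<in> X" "z \<in> X"
  shows "0 \<le> gromov_product x y z" "gromov_product x y z \<le> d x y" "gromov_product x y z \<le> d x z"
  using triangle[of y x z] triangle[of x z y] triangle[of x y z] assms commute
  by (auto simp: gromov_product_def field_simps)

lemma gromov_product_commute: "gromov_product x y z = gromov_product x z y"
  by (simp add: gromov_product_def commute)

text \<open>The point of \<open>segment x y\<close> at distance \<open>gromov_product x y z\<close> from \<open>x\<close> is the median of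
  \<open>x\<close>, \<open>y\<close>, \<open>z\<close>; up to it the segments from \<open>x\<close> to \<open>y\<close> and to \<open>z\<close> coincide.\<close>

lemma in_segment_if_le_gromov_product:
  assumes X: "x \<in> X" "y \<in> X" "z \<in> X" and c: "c \<in> segment x y" and le: "d x c \<le> gromov_product x y z"
  shows "c \<in> segment x z"
proof -
  obtain m where m: "m \<in> segment x y" "d x m = gromov_product x y z"
    using segment_point[of x y] gromov_product_bounds[OF X] X by blast
  have mX: "m \<in> X" and cX: "c \<in> X" using m c by (auto simp: segment_def)
  \<comment> \<open>Whichever of the two other sides contains \<open>m\<close>, its distance from
    \<open>x\<close> gives \<open>d x m + d m z = d x z\<close>.\<close>
  have "m \<in> segment x z \<union> segment z y" using segment_subset_Un[OF X] m by blast
  then have mz: "d x m + d m z = d x z"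
    using m by (auto simp: segment_def gromov_product_def commute field_simps)
  have "d x c + d c z \<le> d x c + (d c m + d m z)" using triangle[OF cX mX X(3)] by simp
  also have "d c m = d x m - d x c" using dist_in_segment[OF X(1,2) c m(1)] m(2) le by simp
  finally have "d x c + d c z \<le> d x z" using mz by simp
  then show ?thesis using triangle[OF X(1) cX X(3)] cX by (auto simp: segment_def)
qed

text \<open>At the distance given by the minimum, a single point \<open>c\<close> lies on the
  segments from \<open>x\<close> to all of \<open>u\<close>, \<open>v\<close>, \<open>w\<close>; the
  way from \<open>u\<close> to \<open>w\<close> through \<open>c\<close> then bounds
  \<open>d u w\<close> from above.\<close>

lemma gromov_product_ultra:
  assumes X: "x \<in> X" "u \<in> X" "v \<in> X" "w \<in> X"
  shows "min (gromov_product x u v) (gromov_product x v w) \<le> gromov_product x u w"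
proof -
  let ?t = "min (gromov_product x u v) (gromov_product x v w)"
  obtain c where c: "c \<in> segment x v" "d x c = ?t"
    using segment_point[of x v ?t] gromov_product_bounds X by (auto simp: min_le_iff_disj)
  have "c \<in> segment x u" "c \<in> segment x w"
    using X c by (auto intro!: in_segment_if_le_gromov_product[of x v] simp: gromov_product_commute[of x v u])
  then show ?thesis
    using triangle[of u c w] X c(2) by (auto simp: segment_def gromov_product_def commute field_simps)
qed

section \<open>Branches and separability\<close>

lemma branch_connected_component:
  assumes p: "p \<in> X" and x: "x \<in> X" "x \<noteq> p"
  obtains B where "branch T B" "connectedin mtopology B" "x \<in> B" "p \<notin> B"
proof (rule that)
  let ?B = "connected_component_of_set (punctured T p) x"
  have top: "topspace (punctured T p) = X - {p}" by (auto simp: punctured_def topology)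
  show "branch T ?B"
    unfolding branch_def connected_components_of_def using p x top by blast
  have "connectedin (punctured T p) ?B" by (rule connectedin_connected_component_of)
  then show "connectedin mtopology ?B" "p \<notin> ?B"
    unfolding punctured_def topology connectedin_subtopology by auto
  show "x \<in> ?B" using x top by (auto simp: connected_component_of_refl)
qed

text \<open>\<open>S\<close> is divided into annuli of width \<open>\<epsilon> / 4\<close> around a
  root \<open>p\<close>. For \<open>x\<close> in an annulus, the path from \<open>p\<close> is cut
  at distance \<open>\<epsilon> / 4\<close> before \<open>x\<close>, and \<open>B x\<close> is the
  branch at the cut that contains \<open>x\<close>. If two such branches met in \<open>v\<close>,
  both cuts would lie on \<open>segment p v\<close>, less than \<open>\<epsilon> / 4\<close> apart,
  and the two points would be closer than \<open>3 * \<epsilon> / 4\<close>. So the branches are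
  disjoint, and positive measure makes them countable.\<close>

lemma countable_separated:
  assumes \<nu>: "finite_measure \<nu>" and pos: "\<And>B. branch T B \<Longrightarrow> 0 < emeasure \<nu> (B \<times> R)"
    and S: "S \<subseteq> X" and \<epsilon>: "0 < \<epsilon>" and sep: "\<And>x y. x \<in> S \<Longrightarrow> y \<in> S \<Longrightarrow> x \<noteq> y \<Longrightarrow> \<epsilon> \<le> d x y"
  shows "countable S"
proof (cases "S = {}")
  case False
  then obtain p where p: "p \<in> X" using S by blast
  define A where "A k = {x \<in> S. real k * (\<epsilon> / 4) \<le> d p x \<and> d p x < real (Suc k) * (\<epsilon> / 4)}" for k
  have annulus: "countable (A k)" if k: "k \<noteq> 0" for k
  proof -
    define cut where "cut x y B \<longleftrightarrow> y \<in> segment p x \<and> d p y = d p x - \<epsilon> / 4 \<and>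
      branch T B \<and> connectedin mtopology B \<and> x \<in> B \<and> y \<notin> B" for x y B
    have "\<exists>y B. cut x y B" if x: "x \<in> A k" for x
    proof -
      have "1 * (\<epsilon> / 4) \<le> real k * (\<epsilon> / 4)" using k \<epsilon> by (intro mult_right_mono) auto
      then have le: "\<epsilon> / 4 \<le> d p x" using x by (auto simp: A_def)
      have xX: "x \<in> X" using x S by (auto simp: A_def)
      obtain y where y: "y \<in> segment p x" "d p y = d p x - \<epsilon> / 4"
        using segment_point[OF p xX, of "d p x - \<epsilon> / 4"] le \<epsilon> by auto
      have "y \<in> X" "x \<noteq> y" using y \<epsilon> by (auto simp: segment_def)
      then obtain B where "branch T B" "connectedin mtopology B" "x \<in> B" "y \<notin> B"
        using branch_connected_component[of y x] xX by metis
      then show ?thesis using y unfolding cut_def by blast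
    qed
    then obtain y B where "\<And>x. x \<in> A k \<Longrightarrow> cut x (y x) (B x)" by metis
    then have y: "\<And>x. x \<in> A k \<Longrightarrow> y x \<in> segment p x" "\<And>x. x \<in> A k \<Longrightarrow> d p (y x) = d p x - \<epsilon> / 4"
      and B: "\<And>x. x \<in> A k \<Longrightarrow> branch T (B x)" "\<And>x. x \<in> A k \<Longrightarrow> connectedin mtopology (B x)"
        "\<And>x. x \<in> A k \<Longrightarrow> x \<in> B x" "\<And>x. x \<in> A k \<Longrightarrow> y x \<notin> B x"
      unfolding cut_def by blast+
    have disj: "B x \<inter> B x' = {}" if x: "x \<in> A k" "x' \<in> A k" "x \<noteq> x'" for x x'
    proof (rule ccontr)
      assume "B x \<inter> B x' \<noteq> {}"
      then obtain v where v: "v \<in> B x" "v \<in> B x'" by blast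
      have X: "v \<in> X" "x \<in> X" "x' \<in> X"
        using v x B(2)[OF x(1)] S connectedin_subset_topspace by (fastforce simp: A_def)+
      \<comment> \<open>The connected set \<open>B z\<close> contains the segment from
        \<open>v\<close> to \<open>z\<close> but not the cut \<open>y z\<close>; by thinness of the
        triangle \<open>p\<close>, \<open>z\<close>, \<open>v\<close>, the cut must lie on the side
        from \<open>p\<close> to \<open>v\<close>.\<close>
      have on_pv: "y z \<in> segment p v" if "z \<in> A k" "v \<in> B z" "z \<in> X" for z
      proof -
        have "segment v z \<subseteq> B z" using that B X by (intro segment_subset_connected) auto
        then have "y z \<notin> segment v z" using B(4)[OF that(1)] by blast
        then show ?thesis using segment_subset_Un[OF p that(3) X(1)] y(1)[OF that(1)] by blast
      qed
      have yX: "y x \<in> X" "y x' \<in> X" using y x by (auto simp: segment_def)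
      have "d (y x) (y x') = \<bar>d p x - d p x'\<bar>"
        using dist_in_segment[OF p X(1) on_pv[OF x(1) v(1) X(2)] on_pv[OF x(2) v(2) X(3)]] y(2) x by simp
      also have "\<dots> < \<epsilon> / 4" unfolding abs_less_iff using x by (auto simp: A_def algebra_simps)
      finally have "d (y x) (y x') < \<epsilon> / 4" .
      moreover have "d x (y x) = \<epsilon> / 4" "d (y x') x' = \<epsilon> / 4"
        using y x by (auto simp: segment_def commute)
      moreover have "d x x' \<le> d x (y x) + (d (y x) (y x') + d (y x') x')"
        using triangle[OF X(2) yX(1) X(3)] triangle[OF yX(1) yX(2) X(3)] by linarith
      moreover have "\<epsilon> \<le> d x x'" using x by (intro sep) (auto simp: A_def)
      ultimately show False using \<epsilon> by linarith
    qed
    show ?thesis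
    proof (rule countable_if_disjoint_positive_measure[OF \<nu>])
      show "disjoint_family_on (\<lambda>x. B x \<times> R) (A k)"
        unfolding disjoint_family_on_def using disj by blast
      show "0 < emeasure \<nu> (B x \<times> R)" if "x \<in> A k" for x using pos B that by blast
    qed
  qed
  \<comment> \<open>Near the root there may be no room for a cut, but the innermost annulus has
    diameter below \<open>\<epsilon>\<close> and contains at most one point of
    \<open>S\<close>.\<close>
  have "countable (A 0)"
  proof -
    have "x = x'" if "x \<in> A 0" "x' \<in> A 0" for x x'
    proof (rule ccontr)
      assume "x \<noteq> x'"
      then have "\<epsilon> \<le> d x x'" using that by (intro sep) (auto simp: A_def)
      moreover have "d x x' \<le> d x p + d p x'" using that S p by (intro triangle) (auto simp: A_def)
      ultimately show False using that \<epsilon> commute[of p x] by (auto simp: A_def)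
    qed
    then have "A 0 = {} \<or> (\<exists>x. A 0 = {x})" by blast
    then show ?thesis by auto
  qed
  then have "countable (A k)" for k using annulus by (cases "k = 0") auto
  then have "countable (\<Union>k. A k)" by (intro countable_UN countableI_type)
  moreover have "S \<subseteq> (\<Union>k. A k)"
  proof
    fix x assume x: "x \<in> S"
    define k where "k = nat \<lfloor>d p x / (\<epsilon> / 4)\<rfloor>"
    have "real k = of_int \<lfloor>d p x / (\<epsilon> / 4)\<rfloor>" using \<epsilon> by (simp add: k_def)
    then have "real k \<le> d p x / (\<epsilon> / 4)" "d p x / (\<epsilon> / 4) < real k + 1" by linarith+
    then have "real k * (\<epsilon> / 4) \<le> d p x" "d p x < real (Suc k) * (\<epsilon> / 4)"
      using \<epsilon> by (simp_all add: field_simps)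
    then show "x \<in> (\<Union>k. A k)" using x by (auto simp: A_def)
  qed
  ultimately show ?thesis by (rule countable_subset[rotated])
next
  case True
  then show ?thesis by (simp only: countable_empty)
qed

text \<open>A maximal \<open>\<epsilon>\<close>-separated set, which exists by Zorn, is an
  \<open>\<epsilon>\<close>-net; the dense set is the union of such nets for
  \<open>\<epsilon> = 1 / (n + 1)\<close>.\<close>

lemma ex_countable_dense:
  assumes \<nu>: "finite_measure \<nu>" and pos: "\<And>B. branch T B \<Longrightarrow> 0 < emeasure \<nu> (B \<times> R)"
  shows "\<exists>Z. countable Z \<and> Z \<subseteq> X \<and> (\<forall>x\<in>X. \<forall>\<epsilon>>0. \<exists>z\<in>Z. d x z < \<epsilon>)"
proof -
  have net: "\<exists>S. countable S \<and> S \<subseteq> X \<and> (\<forall>x\<in>X. \<exists>z\<in>S. d x z < \<epsilon>)" if \<epsilon>: "0 < \<epsilon>" for \<epsilon>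
  proof -
    define \<A> where "\<A> = {S. S \<subseteq> X \<and> (\<forall>x\<in>S. \<forall>y\<in>S. x \<noteq> y \<longrightarrow> \<epsilon> \<le> d x y)}"
    have "\<exists>S\<in>\<A>. \<forall>S'\<in>\<A>. S \<subseteq> S' \<longrightarrow> S' = S"
    proof (rule subset_Zorn_nonempty)
      have "{} \<in> \<A>" by (simp add: \<A>_def)
      then show "\<A> \<noteq> {}" by blast
      fix \<C> assume "\<C> \<noteq> {}" and \<C>: "subset.chain \<A> \<C>"
      have "\<epsilon> \<le> d x y" if xy: "x \<in> \<Union>\<C>" "y \<in> \<Union>\<C>" "x \<noteq> y" for x y
      proof -
        obtain A B where AB: "A \<in> \<C>" "x \<in> A" "B \<in> \<C>" "y \<in> B" using xy by blast
        then have "A \<subseteq> B \<or> B \<subseteq> A" using \<C> by (auto simp: subset_chain_def)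
        moreover have "A \<in> \<A>" "B \<in> \<A>" using AB \<C> by (auto simp: subset_chain_def)
        ultimately show ?thesis using AB xy(3) unfolding \<A>_def by blast
      qed
      moreover have "\<Union>\<C> \<subseteq> X" using \<C> by (fastforce simp: subset_chain_def \<A>_def)
      ultimately show "\<Union>\<C> \<in> \<A>" by (simp add: \<A>_def)
    qed
    then obtain S where S: "S \<in> \<A>" and max: "\<And>S'. S' \<in> \<A> \<Longrightarrow> S \<subseteq> S' \<Longrightarrow> S' = S" by blast
    have "countable S"
      using S by (intro countable_separated[OF \<nu> pos _ \<epsilon>]) (auto simp: \<A>_def)
    moreover have "\<exists>z\<in>S. d x z < \<epsilon>" if x: "x \<in> X" for x
    proof (rule ccontr)
      assume n: "\<not> (\<exists>z\<in>S. d x z < \<epsilon>)"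
      then have "\<epsilon> \<le> d x y" "\<epsilon> \<le> d y x" if "y \<in> S" for y
        using that commute[of y x] by (auto simp: not_less)
      then have "insert x S \<in> \<A>" using S x unfolding \<A>_def by blast
      then have "x \<in> S" using max[of "insert x S"] by blast
      then show False using n x \<epsilon> by auto
    qed
    ultimately show ?thesis using S by (auto simp: \<A>_def)
  qed
  have "\<forall>n. \<exists>S. countable S \<and> S \<subseteq> X \<and> (\<forall>x\<in>X. \<exists>z\<in>S. d x z < 1 / real (Suc n))"
    using net by simp
  then obtain S where S: "\<And>n. countable (S n)" "\<And>n. S n \<subseteq> X"
    "\<And>n x. x \<in> X \<Longrightarrow> \<exists>z\<in>S n. d x z < 1 / real (Suc n)" by metis
  show ?thesis
  proof (intro exI[of _ "\<Union>n. S n"] conjI ballI allI impI)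
    show "countable (\<Union>n. S n)" using S by auto
    show "(\<Union>n. S n) \<subseteq> X" using S by auto
    fix x \<epsilon> assume x: "x \<in> X" and "(0::real) < \<epsilon>"
    then obtain n where "1 / real (Suc n) < \<epsilon>" using reals_Archimedean by (metis inverse_eq_divide)
    moreover obtain z where "z \<in> S n" "d x z < 1 / real (Suc n)" using S(3)[OF x, of n] by blast
    ultimately show "\<exists>z\<in>\<Union>n. S n. d x z < \<epsilon>" by (intro bexI[of _ z]) auto
  qed
qed

end

section \<open>Finite trees from integral Gromov products\<close>

lemma pcas_nth_Suc:
  "pcas u p v \<Longrightarrow> Suc i < length p \<Longrightarrow> snd (p ! i) = fst (p ! Suc i)"
proof (induction p arbitrary: u i)
  case (Cons e p)
  show ?case
  proof (cases i)
    case 0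
    then show ?thesis using Cons.prems by (cases p) auto
  next
    case (Suc i')
    then show ?thesis using Cons.prems Cons.IH[of "snd e" i'] by auto
  qed
qed simp

lemma pcas_last: "pcas u p v \<Longrightarrow> p \<noteq> [] \<Longrightarrow> snd (last p) = v"
  by (induction p arbitrary: u) auto

lemma pcas_hd: "pcas u p v \<Longrightarrow> p \<noteq> [] \<Longrightarrow> fst (hd p) = u"
  by (cases p) auto

lemma pcas_imp_tl_pawalk_verts: "pcas u p v \<Longrightarrow> tl (pawalk_verts u p) = map snd p"
proof (induction p arbitrary: u)
  case (Cons e p)
  then show ?case by (cases p) auto
qed simp

text \<open>At a vertex of maximal depth on a cycle, both neighbours on the cycle are the parent.\<close>

lemma no_long_cycle_if_unique_parent:
  fixes dep :: "'v \<Rightarrow> nat"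
  assumes dep: "\<And>x y. (x, y) \<in> parcs G \<Longrightarrow> dep x \<noteq> dep y"
    and sym: "\<And>x y. (x, y) \<in> parcs G \<Longrightarrow> (y, x) \<in> parcs G"
    and parent: "\<And>x y y'. (x, y) \<in> parcs G \<Longrightarrow> (x, y') \<in> parcs G \<Longrightarrow> dep y < dep x \<Longrightarrow> dep y' < dep x \<Longrightarrow> y = y'"
    and cyc: "pre_digraph.cycle (with_proj G) p" and len: "3 \<le> length p"
  shows False
proof -
  obtain u where "pre_digraph.awalk (with_proj G) u p u"
      and d: "distinct (tl (pre_digraph.awalk_verts (with_proj G) u p))"
    using cyc unfolding pre_digraph.cycle_def by blast
  then have arcs: "set p \<subseteq> parcs G" and cas: "pcas u p u"
    by (auto simp: pre_digraph.awalk_def cas_with_proj_eq)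
  have dist: "distinct (map snd p)"
    using d by (simp add: awalk_verts_with_proj_eq pcas_imp_tl_pawalk_verts[OF cas])
  define n where "n = length p"
  have n: "3 \<le> n" using len by (simp add: n_def)
  have arc: "(fst (p ! i), snd (p ! i)) \<in> parcs G" if "i < n" for i
    using arcs that by (auto simp: n_def)
  have wrap: "snd (p ! (n - 1)) = fst (p ! 0)"
  proof -
    have "p \<noteq> []" using len by auto
    then show ?thesis using pcas_last[OF cas] pcas_hd[OF cas] by (simp add: n_def last_conv_nth hd_conv_nth)
  qed
  define m where "m = Max ((\<lambda>i. dep (snd (p ! i))) ` {..<n})"
  have fin: "finite ((\<lambda>i. dep (snd (p ! i))) ` {..<n})" "(\<lambda>i. dep (snd (p ! i))) ` {..<n} \<noteq> {}"
    using n by (auto simp: lessThan_empty_iff)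
  obtain i where i: "i < n" "dep (snd (p ! i)) = m"
    using Max_in[OF fin] unfolding m_def by auto
  have max: "dep (snd (p ! j)) \<le> dep (snd (p ! i))" if "j < n" for j
    unfolding i(2) m_def using fin that by (intro Max_ge) auto
  \<comment> \<open>\<open>a\<close> and \<open>b\<close> index the arcs before and after arc
    \<open>i\<close> in cyclic order, so the neighbours of the deepest vertex are
    \<open>snd (p ! a)\<close> and \<open>snd (p ! b)\<close>. They have different indices because
    the length is at least 3.\<close>
  define a where "a = (if i = 0 then n - 1 else i - 1)"
  define b where "b = (if i = n - 1 then 0 else i + 1)"
  have ab: "a < n" "b < n" "a \<noteq> b" using n i by (auto simp: a_def b_def)
  have a: "fst (p ! i) = snd (p ! a)"
    using wrap pcas_nth_Suc[OF cas, of "i - 1"] i by (auto simp: a_def n_def)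
  have b: "fst (p ! b) = snd (p ! i)"
    using wrap pcas_nth_Suc[OF cas, of i] i by (auto simp: b_def n_def)
  have "(snd (p ! i), snd (p ! a)) \<in> parcs G" using sym[OF arc[OF i(1)]] a by simp
  moreover have "(snd (p ! i), snd (p ! b)) \<in> parcs G" using arc[OF ab(2)] b by simp
  moreover have "dep (snd (p ! a)) < dep (snd (p ! i))" "dep (snd (p ! b)) < dep (snd (p ! i))"
    using max[OF ab(1)] max[OF ab(2)] dep[OF calculation(1)] dep[OF calculation(2)] by auto
  ultimately have "snd (p ! a) = snd (p ! b)" using parent by blast
  then show False using dist ab by (auto simp: distinct_conv_nth n_def)
qed

section \<open>Rooted trees described by the heights at which paths separate\<close>

locale integral_gromov_product =
  fixes J :: "'j set" and g :: "'j \<Rightarrow> 'j \<Rightarrow> nat"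
  assumes finite_J: "finite J" and J_nonempty: "J \<noteq> {}"
    and g_sym: "\<And>i j. i \<in> J \<Longrightarrow> j \<in> J \<Longrightarrow> g i j = g j i"
    and g_ultra: "\<And>i j k. i \<in> J \<Longrightarrow> j \<in> J \<Longrightarrow> k \<in> J \<Longrightarrow> min (g i j) (g j k) \<le> g i k"
begin

text \<open>By the ultrametric inequality, \<open>k \<le> g i j\<close> is an equivalence relation
  on the points of height at least \<open>k\<close>. A vertex is encoded as its height with its
  equivalence class, the set of all points whose path runs through it.\<close>

definition cluster :: "'j \<times> nat \<Rightarrow> nat \<times> 'j set" where
  "cluster = (\<lambda>(i, k). (k, {j \<in> J. k \<le> g i j}))"

text \<open>Any injection of the finitely many clusters into the naturals; with vertices of one
  fixed type, the trees can form a sequence.\<close>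

definition numbering :: "nat \<times> 'j set \<Rightarrow> nat" where
  "numbering = (SOME f. inj_on f (cluster ` (SIGMA i:J. {..g i i})))"

text \<open>The vertex at height \<open>k\<close> on the path from the root to the point \<open>i\<close>; the paths to \<open>i\<close> and \<open>j\<close>
  separate at height \<open>g i j\<close>.\<close>

definition vert :: "'j \<Rightarrow> nat \<Rightarrow> nat" where
  "vert i k = numbering (cluster (i, k))"

definition graph :: "nat pair_pre_digraph" where
  "graph = \<lparr> pverts = {vert i k | i k. i \<in> J \<and> k \<le> g i i},
     parcs = {(vert i k, vert i (Suc k)) | i k. i \<in> J \<and> Suc k \<le> g i i} \<union>
             {(vert i (Suc k), vert i k) | i k. i \<in> J \<and> Suc k \<le> g i i} \<rparr>"

text \<open>The two paths from the root share a trunk of height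
  \<open>min k (min l (g i j))\<close>.\<close>

definition path_dist :: "'j \<Rightarrow> nat \<Rightarrow> 'j \<Rightarrow> nat \<Rightarrow> nat" where
  "path_dist i k j l = k + l - 2 * min k (min l (g i j))"

lemma inj_on_numbering: "inj_on numbering (cluster ` (SIGMA i:J. {..g i i}))"
proof -
  have "finite (cluster ` (SIGMA i:J. {..g i i}))" using finite_J by auto
  from finite_imp_inj_to_nat_seg[OF this]
  have "\<exists>f :: nat \<times> 'j set \<Rightarrow> nat. inj_on f (cluster ` (SIGMA i:J. {..g i i}))" by metis
  then show ?thesis unfolding numbering_def by (rule someI_ex)
qed

lemma vert_eq_iff:
  assumes "i \<in> J" "j \<in> J" "k \<le> g i i" "l \<le> g j j"
  shows "vert i k = vert j l \<longleftrightarrow> k = l \<and> k \<le> g i j"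
proof -
  have "vert i k = vert j l \<longleftrightarrow> cluster (i, k) = cluster (j, l)"
    unfolding vert_def using assms by (intro inj_on_eq_iff[OF inj_on_numbering]) auto
  also have "\<dots> \<longleftrightarrow> k = l \<and> k \<le> g i j"
  proof
    assume "cluster (i, k) = cluster (j, l)"
    then have "k = l" "j \<in> {j' \<in> J. k \<le> g i j'}" using assms by (auto simp: cluster_def)
    then show "k = l \<and> k \<le> g i j" by auto
  next
    assume *: "k = l \<and> k \<le> g i j"
    have "k \<le> g i m \<longleftrightarrow> k \<le> g j m" if "m \<in> J" for m
      using * g_ultra[of i j m] g_ultra[of j i m] g_sym[of i j] assms that by auto
    with * show "cluster (i, k) = cluster (j, l)" by (auto simp: cluster_def)
  qed
  finally show ?thesis .
qed

text \<open>Well-definedness: the formula depends on the vertex and not on the point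
  \<open>i\<close> that names it.\<close>

lemma path_dist_cong:
  assumes "i \<in> J" "i' \<in> J" "j \<in> J" "k \<le> g i i'"
  shows "path_dist i k j l = path_dist i' k j l"
proof -
  have "min k (g i j) = min k (g i' j)"
  proof (rule antisym)
    show "min k (g i j) \<le> min k (g i' j)"
    proof -
      have "min k (g i j) \<le> min (g i' i) (g i j)" using assms g_sym[of i i'] by (intro min.mono) auto
      also have "\<dots> \<le> g i' j" using assms by (intro g_ultra)
      finally show ?thesis by simp
    qed
    show "min k (g i' j) \<le> min k (g i j)"
    proof -
      have "min k (g i' j) \<le> min (g i i') (g i' j)" using assms by (intro min.mono) auto
      also have "\<dots> \<le> g i j" using assms by (intro g_ultra)
      finally show ?thesis by simp
    qed
  qed
  then show ?thesis unfolding path_dist_def min.left_commute[of k l] by simp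
qed

lemma graph_verts: "pverts graph = {vert i k | i k. i \<in> J \<and> k \<le> g i i}"
  by (simp add: graph_def)

lemma graph_arcs: "parcs graph =
    {(vert i k, vert i (Suc k)) | i k. i \<in> J \<and> Suc k \<le> g i i} \<union>
    {(vert i (Suc k), vert i k) | i k. i \<in> J \<and> Suc k \<le> g i i}"
  by (simp add: graph_def)

lemma finite_graph_verts: "finite (pverts graph)"
proof -
  have "pverts graph = (\<lambda>(i, k). vert i k) ` (SIGMA i:J. {..g i i})" by (auto simp: graph_verts)
  then show ?thesis using finite_J by simp
qed

lemma pair_graph_graph: "pair_graph graph"
proof -
  have sub: "parcs graph \<subseteq> pverts graph \<times> pverts graph"
    unfolding graph_arcs graph_verts using Suc_leD by blast
  then have "finite (parcs graph)" using finite_graph_verts by (meson finite_SigmaI finite_subset)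
  moreover have "fst e \<noteq> snd e" if "e \<in> parcs graph" for e
    using that vert_eq_iff by (auto simp: graph_arcs)
  moreover have "symmetric (with_proj graph)"
    unfolding symmetric_def with_proj_simps by (auto simp: sym_def graph_arcs)
  ultimately show ?thesis
    using sub finite_graph_verts by unfold_locales auto
qed

text \<open>Along an arc the formula changes by at most 1. To see this, the start of the walk is
  first renamed so that it lies on the same path as the arc.\<close>

lemma path_dist_le_length:
  assumes "i \<in> J" "k \<le> g i i" "j \<in> J" "l \<le> g j j" "pcas (vert i k) p (vert j l)" "set p \<subseteq> parcs graph"
  shows "path_dist i k j l \<le> length p"
  using assms
proof (induction p arbitrary: i k)
  case Nil
  then have "k = l" "k \<le> g i j" using vert_eq_iff[of i j k l] by auto
  then show ?case by (simp add: path_dist_def)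
next
  case (Cons e p)
  obtain i' m m' where e: "e = (vert i' m, vert i' m')" "i' \<in> J" "m \<le> g i' i'" "m' \<le> g i' i'"
      "m' = Suc m \<or> m = Suc m'"
  proof -
    have "e \<in> parcs graph" using Cons.prems by auto
    then show ?thesis using that by (auto simp: graph_arcs)
  qed
  have eq: "k = m" "k \<le> g i i'" using Cons.prems e vert_eq_iff[of i i' k m] by auto
  have "path_dist i k j l = path_dist i' m j l"
    using path_dist_cong[of i i' j k l] eq Cons.prems e by simp
  also have "\<dots> \<le> Suc (path_dist i' m' j l)"
    using e(5) unfolding path_dist_def by (auto simp: min_def)
  also have "path_dist i' m' j l \<le> length p"
    using Cons.prems e by (intro Cons.IH) auto
  finally show ?case by simp
qed

text \<open>A greedy walk: above the height where the paths separate it descends, otherwise it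
  climbs towards \<open>j\<close>; each step lowers \<open>path_dist\<close> by exactly 1.\<close>

lemma walk_of_length_path_dist:
  assumes "i \<in> J" "k \<le> g i i" "j \<in> J" "l \<le> g j j"
  shows "\<exists>p. pcas (vert i k) p (vert j l) \<and> set p \<subseteq> parcs graph \<and> length p = path_dist i k j l"
  using assms
proof (induction "path_dist i k j l" arbitrary: i k)
  case 0
  then have "k + l \<le> 2 * min k (min l (g i j))" by (simp add: path_dist_def)
  moreover have "min k (min l (g i j)) \<le> k" "min k (min l (g i j)) \<le> l" "min k (min l (g i j)) \<le> g i j"
    by simp_all
  ultimately have "k = l" "k \<le> g i j" by linarith+
  then have "vert i k = vert j l" using vert_eq_iff[of i j k l] 0 by auto
  with 0 show ?case by (intro exI[of _ "[]"]) auto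
next
  case (Suc n)
  have "\<exists>i' k'. i' \<in> J \<and> k' \<le> g i' i' \<and> (vert i k, vert i' k') \<in> parcs graph \<and> path_dist i' k' j l = n"
  proof (cases "min l (g i j) < k")
    case True
    then obtain k' where k': "k = Suc k'" by (cases k) auto
    have "min l (g i j) \<le> k'" "min l (g i j) \<le> l" using True k' by simp_all
    moreover from this have "Suc n = Suc k' + l - 2 * min l (g i j)" "path_dist i k' j l = k' + l - 2 * min l (g i j)"
      using Suc.hyps(2) k' by (simp_all add: path_dist_def min_absorb2)
    ultimately have "path_dist i k' j l = n" by linarith
    moreover have "(vert i k, vert i k') \<in> parcs graph" using Suc.prems k' by (auto simp: graph_arcs)
    ultimately show ?thesis using Suc.prems k' by (intro exI[of _ i] exI[of _ k']) auto
  next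
    case False
    then have k: "k \<le> l" "k \<le> g i j" by simp_all
    then have "Suc n = k + l - 2 * k" using Suc.hyps(2) by (simp add: path_dist_def)
    then have kl: "k < l" "l = Suc (n + k)" by linarith+
    \<comment> \<open>Up to the separation height, the current vertex already lies on the path to
      \<open>j\<close>.\<close>
    have "vert i k = vert j k" using k kl Suc.prems vert_eq_iff[of i j k k] by auto
    moreover have "(vert j k, vert j (Suc k)) \<in> parcs graph"
    proof -
      have "Suc k \<le> g j j" using kl Suc.prems by simp
      then show ?thesis unfolding graph_arcs using Suc.prems(3) by blast
    qed
    ultimately have "(vert i k, vert j (Suc k)) \<in> parcs graph" by simp
    moreover have "path_dist j (Suc k) j l = n" using kl Suc.prems by (simp add: path_dist_def)
    ultimately show ?thesis using Suc.prems kl by (intro exI[of _ j] exI[of _ "Suc k"]) auto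
  qed
  then obtain i' k' where *: "i' \<in> J" "k' \<le> g i' i'" "(vert i k, vert i' k') \<in> parcs graph"
    "path_dist i' k' j l = n" by blast
  from Suc.hyps(1)[OF *(4)[symmetric] *(1,2) Suc.prems(3,4)] obtain p where
    "pcas (vert i' k') p (vert j l)" "set p \<subseteq> parcs graph" "length p = path_dist i' k' j l" by blast
  then show ?case using * Suc.hyps(2) by (intro exI[of _ "(vert i k, vert i' k') # p"]) auto
qed

lemma awalk_graph_iff:
  assumes "i \<in> J" "k \<le> g i i"
  shows "pre_digraph.awalk (with_proj graph) (vert i k) p v \<longleftrightarrow> set p \<subseteq> parcs graph \<and> pcas (vert i k) p v"
  using assms by (auto simp: pre_digraph.awalk_def cas_with_proj_eq graph_verts)

lemma graph_dist_vert:
  assumes "i \<in> J" "k \<le> g i i" "j \<in> J" "l \<le> g j j"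
  shows "graph_dist graph (vert i k) (vert j l) = path_dist i k j l"
  unfolding graph_dist_def awalk_graph_iff[OF assms(1,2)]
  using walk_of_length_path_dist[OF assms] path_dist_le_length[OF assms] by (intro Least_equality) auto

text \<open>The height serves as depth. The lower neighbour of a vertex is unique, because paths
  that agree at height \<open>k + 1\<close> agree at height \<open>k\<close>.\<close>

lemma finite_tree_graph: "finite_tree graph"
  unfolding finite_tree_def
proof (intro conjI notI)
  show "pair_graph graph" by (rule pair_graph_graph)
  then interpret pair_graph graph .
  show "Digraph_Component.connected (with_proj graph)"
    unfolding Digraph_Component.connected_def
  proof (rule strongly_connectedI)
    show "verts (with_proj (mk_symmetric (with_proj graph))) \<noteq> {}"
      using J_nonempty by (auto simp: graph_verts)
  next
    fix u v assume "u \<in> verts (with_proj (mk_symmetric (with_proj graph)))"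
      "v \<in> verts (with_proj (mk_symmetric (with_proj graph)))"
    then obtain i k j l where uv: "u = vert i k" "i \<in> J" "k \<le> g i i" "v = vert j l" "j \<in> J" "l \<le> g j j"
      by (auto simp: graph_verts)
    from walk_of_length_path_dist[of i k j l] uv obtain p where "awalk u p v"
      using awalk_graph_iff[of i k _ v] by auto
    then have "u \<rightarrow>\<^sup>*\<^bsub>with_proj graph\<^esub> v" using reachable_awalk by blast
    then show "u \<rightarrow>\<^sup>*\<^bsub>with_proj (mk_symmetric (with_proj graph))\<^esub> v"
      by (rule reachable_mk_symmetricI)
  qed
next
  define dep where "dep v = (THE k. \<exists>i\<in>J. k \<le> g i i \<and> v = vert i k)" for v
  have dep: "dep (vert i k) = k" if "i \<in> J" "k \<le> g i i" for i k
    unfolding dep_def using that vert_eq_iff by (intro the_equality) auto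
  assume "\<exists>c. pre_digraph.cycle (with_proj graph) c \<and> 3 \<le> length c"
  then obtain c where c: "pre_digraph.cycle (with_proj graph) c" "3 \<le> length c" by blast
  show False
  proof (rule no_long_cycle_if_unique_parent[OF _ _ _ c, of dep])
    fix x y assume "(x, y) \<in> parcs graph"
    then show "dep x \<noteq> dep y" "(y, x) \<in> parcs graph" by (auto simp: graph_arcs dep)
  next
    fix x y y' assume *: "(x, y) \<in> parcs graph" "(x, y') \<in> parcs graph" "dep y < dep x" "dep y' < dep x"
    have down: "\<exists>i k. x = vert i (Suc k) \<and> z = vert i k \<and> i \<in> J \<and> Suc k \<le> g i i"
      if "(x, z) \<in> parcs graph" "dep z < dep x" for z
      using that unfolding graph_arcs by (auto simp: dep)
    obtain i k i' k' where "x = vert i (Suc k)" "y = vert i k" "i \<in> J" "Suc k \<le> g i i"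
       "x = vert i' (Suc k')" "y' = vert i' k'" "i' \<in> J" "Suc k' \<le> g i' i'"
      using down[OF *(1,3)] down[OF *(2,4)] by metis
    then show "y = y'" using vert_eq_iff[of i i' "Suc k" "Suc k'"] vert_eq_iff[of i i' k k'] by auto
  qed
qed

end

text \<open>Every branch \<open>b\<close> is a path of length \<open>H b - 1\<close> from the root with \<open>M b\<close> leaves attached to its
  end, so that almost all vertices of the tree are leaves; \<open>None\<close> stands for an additional path of
  length \<open>h\<close>, which serves to adjust the diameter.\<close>

fun bushy_product :: "('b \<Rightarrow> 'b \<Rightarrow> nat) \<Rightarrow> ('b \<Rightarrow> nat) \<Rightarrow> nat \<Rightarrow> ('b \<times> nat) option \<Rightarrow> ('b \<times> nat) option \<Rightarrow> nat" where
  "bushy_product \<gamma> H h None None = h"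
| "bushy_product \<gamma> H h None (Some y) = 0"
| "bushy_product \<gamma> H h (Some x) None = 0"
| "bushy_product \<gamma> H h (Some (b, e)) (Some (b', e')) =
     (if b \<noteq> b' then \<gamma> b b' else if e \<noteq> e' then H b - 1 else H b)"

section \<open>Trees with bundles of leaves at the ends of their branches\<close>

locale bushy_tree =
  fixes S :: "'b set" and \<gamma> :: "'b \<Rightarrow> 'b \<Rightarrow> nat" and H M :: "'b \<Rightarrow> nat" and h :: nat
  assumes finite_S: "finite S" and S_nonempty: "S \<noteq> {}"
    and \<gamma>_sym: "\<And>b c. b \<in> S \<Longrightarrow> c \<in> S \<Longrightarrow> \<gamma> b c = \<gamma> c b"
    and \<gamma>_le: "\<And>b c. b \<in> S \<Longrightarrow> c \<in> S \<Longrightarrow> \<gamma> b c < H b"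
    and \<gamma>_ultra: "\<And>b c c'. b \<in> S \<Longrightarrow> c \<in> S \<Longrightarrow> c' \<in> S \<Longrightarrow> min (\<gamma> b c) (\<gamma> c c') \<le> \<gamma> b c'"
    and M_pos: "\<And>b. b \<in> S \<Longrightarrow> 0 < M b"
begin

definition leaf_index :: "('b \<times> nat) set" where
  "leaf_index = (SIGMA b:S. {..<M b})"

definition index :: "('b \<times> nat) option set" where
  "index = insert None (Some ` leaf_index)"

abbreviation g where "g \<equiv> bushy_product \<gamma> H h"

lemma finite_leaf_index: "finite leaf_index"
  using finite_S by (simp add: leaf_index_def)

text \<open>The strict bound \<open>\<gamma> b c < H b\<close> matters when the outer indices lie on
  one branch \<open>b\<close> and the middle one on another branch \<open>c\<close>: two leaves of
  \<open>b\<close> separate at height \<open>H b - 1\<close> at the earliest.\<close>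

lemma g_ultra:
  assumes "i \<in> index" "j \<in> index" "k \<in> index"
  shows "min (g i j) (g j k) \<le> g i k"
proof (cases "i = None \<or> j = None \<or> k = None")
  case True
  then show ?thesis by (cases i; cases j; cases k) auto
next
  case False
  then obtain b e c e' b'' e'' where [simp]: "i = Some (b, e)" "j = Some (c, e')" "k = Some (b'', e'')"
    by (metis not_None_eq surj_pair)
  have S: "b \<in> S" "c \<in> S" "b'' \<in> S" using assms by (auto simp: index_def leaf_index_def)
  show ?thesis
  proof (cases "b = b''")
    case True
    then show ?thesis using \<gamma>_le[of b c] S by (auto simp: min_le_iff_disj)
  next
    case False
    then show ?thesis using \<gamma>_ultra[OF S] by auto
  qed
qed

sublocale integral_gromov_product index g
proof
  show "finite index" using finite_leaf_index by (simp add: index_def)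
  show "index \<noteq> {}" by (simp add: index_def)
  show "g i j = g j i" if "i \<in> index" "j \<in> index" for i j
    using that \<gamma>_sym by (cases i; cases j) (auto simp: index_def leaf_index_def)
qed (rule g_ultra)

definition leaf :: "'b \<times> nat \<Rightarrow> nat" where
  "leaf x = vert (Some x) (H (fst x))"

lemma leaf_in_verts: "x \<in> leaf_index \<Longrightarrow> leaf x \<in> pverts graph"
  unfolding graph_verts leaf_def
  by (cases x) (auto simp: index_def intro!: exI[of _ "Some x"])

lemma leaf_eq_vert_iff:
  assumes "x \<in> leaf_index" "y \<in> leaf_index" "k \<le> H (fst y)"
  shows "leaf x = vert (Some y) k \<longleftrightarrow> x = y \<and> k = H (fst y)"
proof -
  obtain b e c e' where [simp]: "x = (b, e)" "y = (c, e')" by fastforce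
  have S: "b \<in> S" "c \<in> S" using assms by (auto simp: leaf_index_def)
  have "leaf x = vert (Some y) k \<longleftrightarrow> H b = k \<and> H b \<le> g (Some x) (Some y)"
    unfolding leaf_def using assms by (subst vert_eq_iff) (auto simp: index_def)
  then show ?thesis using \<gamma>_le[OF S] \<gamma>_le[OF S(1,1)] by auto
qed

lemma inj_on_leaf: "inj_on leaf leaf_index"
proof (rule inj_onI)
  fix x y assume "x \<in> leaf_index" "y \<in> leaf_index" "leaf x = leaf y"
  then show "x = y" using leaf_eq_vert_iff[of x y "H (fst y)"] by (simp add: leaf_def[of y])
qed

lemma card_leaves: "card (leaf ` leaf_index) = (\<Sum>b\<in>S. M b)"
proof -
  have "card (leaf ` leaf_index) = card leaf_index" by (rule card_image[OF inj_on_leaf])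
  then show ?thesis using finite_S by (simp add: leaf_index_def)
qed

lemma vert_lower_eq:
  assumes "b \<in> S" "e < M b" "e' < M b" "k < H b"
  shows "vert (Some (b, e)) k = vert (Some (b, e')) k"
  using assms by (subst vert_eq_iff) (auto simp: index_def leaf_index_def)

text \<open>Below its last edge the path to a leaf depends only on the branch. The bound is thus
  independent of the numbers \<open>M b\<close>, which can be made large afterwards.\<close>

lemma card_nonleaves: "card (pverts graph - leaf ` leaf_index) \<le> (\<Sum>b\<in>S. H b) + h + 1"
proof -
  let ?A = "(\<lambda>(b, k). vert (Some (b, 0)) k) ` (SIGMA b:S. {..<H b})" and ?B = "vert None ` {..h}"
  have "pverts graph - leaf ` leaf_index \<subseteq> ?A \<union> ?B"
  proof
    fix v assume v: "v \<in> pverts graph - leaf ` leaf_index"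
    then obtain i k where i: "v = vert i k" "i \<in> index" "k \<le> g i i" by (auto simp: graph_verts)
    show "v \<in> ?A \<union> ?B"
    proof (cases i)
      case None
      then show ?thesis using i by auto
    next
      case (Some x)
      then obtain b e where x: "i = Some (b, e)" "b \<in> S" "e < M b"
        using i by (cases x) (auto simp: index_def leaf_index_def)
      have "k \<noteq> H b"
        using v i(1) x by (auto simp: leaf_index_def leaf_def intro: rev_image_eqI[of "(b, e)"])
      then have "k < H b" using i(3) x by simp
      then have "v = vert (Some (b, 0)) k" "(b, k) \<in> (SIGMA b:S. {..<H b})"
        using vert_lower_eq[OF x(2,3), of 0 k] M_pos[OF x(2)] i(1) x by auto
      then show ?thesis by (auto intro!: rev_image_eqI[of "(b, k)"])
    qed
  qed
  then have "card (pverts graph - leaf ` leaf_index) \<le> card (?A \<union> ?B)"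
    using finite_S by (intro card_mono) auto
  also have "\<dots> \<le> card ?A + card ?B" by (rule card_Un_le)
  also have "\<dots> \<le> card (SIGMA b:S. {..<H b}) + card {..h}"
    using finite_S by (intro add_mono card_image_le) auto
  also have "\<dots> = (\<Sum>b\<in>S. H b) + h + 1" using finite_S by simp
  finally show ?thesis .
qed

lemma graph_dist_leaves:
  assumes "x \<in> leaf_index" "y \<in> leaf_index" "fst x \<noteq> fst y"
  shows "graph_dist graph (leaf x) (leaf y) = H (fst x) + H (fst y) - 2 * \<gamma> (fst x) (fst y)"
proof -
  obtain b e c e' where [simp]: "x = (b, e)" "y = (c, e')" by fastforce
  have S: "b \<in> S" "c \<in> S" using assms by (auto simp: leaf_index_def)
  have "graph_dist graph (leaf x) (leaf y) = path_dist (Some x) (H b) (Some y) (H c)"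
    unfolding leaf_def using assms by (subst graph_dist_vert) (auto simp: index_def)
  moreover have "min (H b) (min (H c) (\<gamma> b c)) = \<gamma> b c"
    using \<gamma>_le[OF S] \<gamma>_le[OF S(2,1)] \<gamma>_sym[OF S] by simp
  ultimately show ?thesis using assms by (simp add: path_dist_def)
qed

text \<open>According to the term that realizes the minimum, the distance is a difference of heights
  or at most the distance of the two tops.\<close>

lemma path_dist_le:
  assumes "i \<in> index" "j \<in> index" "k \<le> g i i" "l \<le> g j j"
    and "g i i \<le> D" "g j j \<le> D" "g i i + g j j \<le> D + 2 * g i j"
  shows "path_dist i k j l \<le> D"
proof -
  consider "min k (min l (g i j)) = k" | "min k (min l (g i j)) = l" | "min k (min l (g i j)) = g i j"
    by (metis min_def)
  then show ?thesis using assms by cases (simp_all add: path_dist_def)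
qed

lemma graph_dist_le:
  assumes u: "u \<in> pverts graph" and v: "v \<in> pverts graph"
    and D: "2 \<le> D" "h \<le> D" "\<And>b. b \<in> S \<Longrightarrow> h + H b \<le> D"
      "\<And>b c. b \<in> S \<Longrightarrow> c \<in> S \<Longrightarrow> H b + H c \<le> D + 2 * \<gamma> b c"
  shows "graph_dist graph u v \<le> D"
proof -
  obtain i k where i: "u = vert i k" "i \<in> index" "k \<le> g i i" using u by (auto simp: graph_verts)
  obtain j l where j: "v = vert j l" "j \<in> index" "l \<le> g j j" using v by (auto simp: graph_verts)
  have le: "g m m \<le> D" if "m \<in> index" for m
    using that D(2) D(3) by (cases m) (fastforce simp: index_def leaf_index_def)+
  have "g i i + g j j \<le> D + 2 * g i j"
  proof (cases "i = None \<or> j = None")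
    case True
    then show ?thesis using i(2) j(2) D(2) D(3)
      by (cases i; cases j) (fastforce simp: index_def leaf_index_def add.commute)+
  next
    case False
    then obtain b e c e' where [simp]: "i = Some (b, e)" "j = Some (c, e')"
      by (metis not_None_eq surj_pair)
    have S: "b \<in> S" "c \<in> S" using i j by (auto simp: index_def leaf_index_def)
    \<comment> \<open>\<open>2 \<le> D\<close> covers two leaves on one branch, which are at
      distance 2.\<close>
    show ?thesis using D(4)[OF S] D(1) by auto
  qed
  then show ?thesis
    unfolding i(1) j(1) graph_dist_vert[OF i(2,3) j(2,3)] using i j le by (intro path_dist_le) auto
qed

text \<open>The extra path meets the rest of the tree only in the root, so its end realizes the sum
  of the heights. This provides the lower bound on the diameter.\<close>

lemma graph_dist_spur:
  assumes "b \<in> S"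
  obtains u v where "u \<in> pverts graph" "v \<in> pverts graph" "graph_dist graph u v = h + H b"
proof
  have i: "Some (b, 0) \<in> index" "None \<in> index"
    using assms M_pos by (auto simp: index_def leaf_index_def)
  show "vert None h \<in> pverts graph" "vert (Some (b, 0)) (H b) \<in> pverts graph"
    unfolding graph_verts using i by fastforce+
  show "graph_dist graph (vert None h) (vert (Some (b, 0)) (H b)) = h + H b"
    using i by (subst graph_dist_vert) (auto simp: path_dist_def)
qed

lemma finite_graph_dists:
  "finite {graph_dist graph x y | x y. x \<in> pverts graph \<and> y \<in> pverts graph}"
proof -
  have "{graph_dist graph x y | x y. x \<in> pverts graph \<and> y \<in> pverts graph}
     = (\<lambda>(x, y). graph_dist graph x y) ` (pverts graph \<times> pverts graph)" by auto
  then show ?thesis using finite_graph_verts by simp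
qed

lemma graph_dist_le_diam:
  assumes "u \<in> pverts graph" "v \<in> pverts graph"
  shows "graph_dist graph u v \<le> graph_diam graph"
  unfolding graph_diam_def using assms finite_graph_dists by (intro Max_ge) auto

lemma graph_diam_ge:
  assumes "b \<in> S"
  shows "h + H b \<le> graph_diam graph"
proof -
  obtain u v where "u \<in> pverts graph" "v \<in> pverts graph" "graph_dist graph u v = h + H b"
    by (rule graph_dist_spur[OF assms])
  then show ?thesis using graph_dist_le_diam by metis
qed

lemma graph_diam_le:
  assumes "2 \<le> D" "h \<le> D" "\<And>b. b \<in> S \<Longrightarrow> h + H b \<le> D"
      "\<And>b c. b \<in> S \<Longrightarrow> c \<in> S \<Longrightarrow> H b + H c \<le> D + 2 * \<gamma> b c"
  shows "graph_diam graph \<le> D"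
  unfolding graph_diam_def
proof (rule Max.boundedI)
  obtain b where "b \<in> S" using S_nonempty by blast
  then obtain u v where "u \<in> pverts graph" "v \<in> pverts graph" "graph_dist graph u v = h + H b"
    by (rule graph_dist_spur)
  then show "{graph_dist graph x y |x y. x \<in> pverts graph \<and> y \<in> pverts graph} \<noteq> {}"
    by blast
  show "x \<le> D" if "x \<in> {graph_dist graph x y |x y. x \<in> pverts graph \<and> y \<in> pverts graph}" for x
    using that graph_dist_le[OF _ _ assms] by auto
qed (rule finite_graph_dists)

lemma nontrivial_finite_tree_graph: "nontrivial_finite_tree graph"
proof -
  obtain b where b: "b \<in> S" using S_nonempty by blast
  then have i: "Some (b, 0) \<in> index" and H: "0 < H b"
    using M_pos \<gamma>_le[OF b b] by (auto simp: index_def leaf_index_def)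
  have "vert (Some (b, 0)) 0 \<noteq> vert (Some (b, 0)) (H b)"
    using i H by (subst vert_eq_iff) auto
  moreover have "vert (Some (b, 0)) 0 \<in> pverts graph" "vert (Some (b, 0)) (H b) \<in> pverts graph"
    unfolding graph_verts using i by fastforce+
  ultimately have "card {vert (Some (b, 0)) 0, vert (Some (b, 0)) (H b)} \<le> card (pverts graph)"
    by (intro card_mono finite_graph_verts) auto
  with \<open>vert (Some (b, 0)) 0 \<noteq> vert (Some (b, 0)) (H b)\<close> show ?thesis
    by (simp add: nontrivial_finite_tree_def finite_tree_graph)
qed

end

lemma floor_mult_bounds:
  fixes x :: real
  assumes "0 \<le> x"
  shows "x - 1 < real (nat \<lfloor>x\<rfloor>)" "real (nat \<lfloor>x\<rfloor>) \<le> x"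
  using assms by linarith+

section \<open>Counting vertices and pairs of vertices by branches\<close>

context bushy_tree
begin

text \<open>Meaningful on leaves only; elsewhere \<open>inv_into\<close> yields an arbitrary
  value.\<close>

definition branch_of :: "nat \<Rightarrow> 'b" where
  "branch_of v = fst (inv_into leaf_index leaf v)"

lemma branch_of_leaf: "x \<in> leaf_index \<Longrightarrow> branch_of (leaf x) = fst x"
  by (simp add: branch_of_def inv_into_f_f[OF inj_on_leaf])

definition nonleaves :: "nat set" where
  "nonleaves = pverts graph - leaf ` leaf_index"

lemma card_verts: "card (pverts graph) = (\<Sum>b\<in>S. M b) + card nonleaves"
proof -
  have "pverts graph = leaf ` leaf_index \<union> nonleaves"
    using leaf_in_verts by (auto simp: nonleaves_def)
  moreover have "finite nonleaves" using finite_graph_verts by (simp add: nonleaves_def)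
  moreover have "leaf ` leaf_index \<inter> nonleaves = {}" by (auto simp: nonleaves_def)
  ultimately have "card (pverts graph) = card (leaf ` leaf_index) + card nonleaves"
    using finite_leaf_index by (metis card_Un_disjoint finite_imageI)
  then show ?thesis by (simp add: card_leaves)
qed

lemma card_leaves_of:
  assumes "B \<subseteq> S"
  shows "card {v \<in> leaf ` leaf_index. branch_of v \<in> B} = (\<Sum>b\<in>B. M b)"
proof -
  have "{v \<in> leaf ` leaf_index. branch_of v \<in> B} = leaf ` (SIGMA b:B. {..<M b})"
    using assms by (auto simp: branch_of_leaf leaf_index_def intro!: imageI)
  moreover have "inj_on leaf (SIGMA b:B. {..<M b})"
    using assms by (intro inj_on_subset[OF inj_on_leaf]) (auto simp: leaf_index_def)
  moreover have "finite B" using assms finite_S finite_subset by blast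
  ultimately show ?thesis by (simp add: card_image)
qed

text \<open>The distance formula for leaves applies to a pair unless one vertex is not a leaf or
  both share a branch. The first kind is rare if there are many leaves, the second if each label
  owns many branches.\<close>

lemma card_bad_pairs:
  "card {(u, v) \<in> pverts graph \<times> pverts graph.
      u \<in> nonleaves \<or> v \<in> nonleaves \<or> branch_of u = branch_of v}
    \<le> 2 * card nonleaves * card (pverts graph) + (\<Sum>b\<in>S. M b * M b)"
proof -
  let ?V = "pverts graph"
  define L where "L b = {v \<in> leaf ` leaf_index. branch_of v \<in> {b}}" for b
  have fin: "finite ?V" "finite nonleaves" using finite_graph_verts by (auto simp: nonleaves_def)
  have finL: "finite (L b)" for b using finite_leaf_index by (auto simp: L_def)
  have "{(u, v) \<in> ?V \<times> ?V. u \<in> nonleaves \<or> v \<in> nonleaves \<or> branch_of u = branch_of v}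
     \<subseteq> (nonleaves \<times> ?V \<union> ?V \<times> nonleaves) \<union> (\<Union>b\<in>S. L b \<times> L b)"
  proof
    fix z assume "z \<in> {(u, v) \<in> ?V \<times> ?V. u \<in> nonleaves \<or> v \<in> nonleaves \<or> branch_of u = branch_of v}"
    then obtain u v where z: "z = (u, v)" "u \<in> ?V" "v \<in> ?V"
      "u \<in> nonleaves \<or> v \<in> nonleaves \<or> branch_of u = branch_of v" by blast
    show "z \<in> (nonleaves \<times> ?V \<union> ?V \<times> nonleaves) \<union> (\<Union>b\<in>S. L b \<times> L b)"
    proof (cases "u \<in> nonleaves \<or> v \<in> nonleaves")
      case True
      then show ?thesis using z by blast
    next
      case False
      then have uv: "u \<in> leaf ` leaf_index" "v \<in> leaf ` leaf_index" using z by (auto simp: nonleaves_def)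
      then have "branch_of u \<in> S" by (auto simp: branch_of_leaf leaf_index_def)
      moreover have "(u, v) \<in> L (branch_of u) \<times> L (branch_of u)"
        using uv False z(4) by (auto simp: L_def)
      ultimately show ?thesis using z(1) by blast
    qed
  qed
  then have "card {(u, v) \<in> ?V \<times> ?V. u \<in> nonleaves \<or> v \<in> nonleaves \<or> branch_of u = branch_of v}
     \<le> card ((nonleaves \<times> ?V \<union> ?V \<times> nonleaves) \<union> (\<Union>b\<in>S. L b \<times> L b))"
    using fin finL finite_S by (intro card_mono) auto
  also have "\<dots> \<le> (card (nonleaves \<times> ?V) + card (?V \<times> nonleaves)) + card (\<Union>b\<in>S. L b \<times> L b)"
    by (intro order_trans[OF card_Un_le] add_mono card_Un_le order_refl)
  also have "card (\<Union>b\<in>S. L b \<times> L b) \<le> (\<Sum>b\<in>S. card (L b \<times> L b))"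
    by (rule card_UN_le[OF finite_S])
  also have "\<dots> = (\<Sum>b\<in>S. M b * M b)"
    unfolding L_def card_cartesian_product using card_leaves_of[of "{_}"] by (intro sum.cong) auto
  also have "card (nonleaves \<times> ?V) + card (?V \<times> nonleaves) = 2 * card nonleaves * card ?V"
    by (simp add: card_cartesian_product)
  finally show ?thesis by simp
qed

end

section \<open>Approximation of a finite weighted tree metric with heights\<close>

locale weighted_tree_metric =
  fixes I :: "'i set" and e :: "'i \<Rightarrow> 'i \<Rightarrow> real" and a w :: "'i \<Rightarrow> real" and base :: 'i and \<kappa> :: real
  assumes finite_I: "finite I" and base_in_I: "base \<in> I"
    and e_sym: "\<And>l m. l \<in> I \<Longrightarrow> m \<in> I \<Longrightarrow> e l m = e m l"
    and e_tri: "\<And>l m n. l \<in> I \<Longrightarrow> m \<in> I \<Longrightarrow> n \<in> I \<Longrightarrow> e l n \<le> e l m + e m n"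
    and e_nonneg: "\<And>l m. l \<in> I \<Longrightarrow> m \<in> I \<Longrightarrow> 0 \<le> e l m"
    and e_ultra: "\<And>l m n. l \<in> I \<Longrightarrow> m \<in> I \<Longrightarrow> n \<in> I \<Longrightarrow>
      min ((e base l + e base m - e l m) / 2) ((e base m + e base n - e m n) / 2) \<le> (e base l + e base n - e l n) / 2"
    and a_nonneg: "\<And>l. l \<in> I \<Longrightarrow> 0 \<le> a l"
    and bound: "\<And>l m. l \<in> I \<Longrightarrow> m \<in> I \<Longrightarrow> e l m + a l + a m \<le> 1 + \<kappa>"
    and w_nonneg: "\<And>l. l \<in> I \<Longrightarrow> 0 \<le> w l" and w_sum: "(\<Sum>l\<in>I. w l) = 1"
    and \<kappa>: "0 < \<kappa>" "\<kappa> \<le> 1"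
begin

text \<open>The Gromov product at \<open>base\<close>, which becomes the root;
  \<open>e_ultra\<close> is the four-point condition for it, spelled out.\<close>

definition gp :: "'i \<Rightarrow> 'i \<Rightarrow> real" where
  "gp l m = (e base l + e base m - e l m) / 2"

lemma gp_bounds:
  assumes "l \<in> I" "m \<in> I"
  shows "0 \<le> gp l m" "gp l m \<le> e base l"
  using e_tri[of l base m] e_tri[of base l m] e_sym[of l base] assms base_in_I by (auto simp: gp_def)

text \<open>Three scales are fixed in turn: \<open>m\<close> branches per label, edges of length
  about \<open>1 / N\<close>, and about \<open>w l * Q\<close> leaves per branch. \<open>Q\<close>
  comes last, as it has to outweigh the number \<open>R\<close> of inner vertices, which depends on
  \<open>m\<close> and \<open>N\<close>.\<close>

lemma tree_approximation:
  assumes \<delta>: "0 < \<delta>"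
  obtains G :: "nat pair_pre_digraph" and t where "nontrivial_finite_tree G" "finite (pverts G)"
    "t \<in> pverts G \<rightarrow> I"
    "\<forall>l\<in>I. \<bar>real (card {v \<in> pverts G. t v = l}) / real (card (pverts G)) - w l\<bar> \<le> \<delta>"
    "real (card {(u, v) \<in> pverts G \<times> pverts G.
       \<not> \<bar>tree_dist G u v - (e (t u) (t v) + a (t u) + a (t v))\<bar> \<le> 3 * \<kappa>}) \<le> \<delta> * real (card (pverts G)) ^ 2"
    "\<forall>u\<in>pverts G. \<forall>v\<in>pverts G. tree_dist G u v \<in> {0..1}"
proof -
  define m where "m = nat \<lceil>2 / \<delta>\<rceil>"
  \<comment> \<open>Two random leaves share a branch with probability at most
    \<open>1 / m \<le> \<delta> / 2\<close>; inner vertices may use the other half of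
    \<open>\<delta>\<close>.\<close>
  have m: "2 / \<delta> \<le> real m" unfolding m_def by linarith
  have m0: "0 < m" using m \<delta> by (cases "m = 0") (auto simp: field_simps)
  \<comment> \<open>The 12 is 4 for rounding in the distance of two leaves plus \<open>4 * 2\<close>
    for rounding in the diameter, multiplied by a distance of at most 2; all of it shall be at most
    \<open>N * \<kappa>\<close>.\<close>
  obtain N :: nat where "max 2 (12 / \<kappa>) \<le> real N" using real_arch_simple by blast
  then have N2: "2 \<le> N" and N\<kappa>: "12 / \<kappa> \<le> real N" by auto
  have N0: "0 < real N" using N2 by simp
  define S where "S = I \<times> {..<m}"
  define \<gamma> where "\<gamma> b c = nat \<lfloor>real N * gp (fst b) (fst c)\<rfloor>" for b c :: "'i \<times> nat"
  \<comment> \<open>The first floor dominates every \<open>\<gamma>\<close> at the label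
    \<open>l\<close>; the 1 for the edge to the leaf makes the bound strict.\<close>
  define H' where "H' l = nat \<lfloor>real N * e base l\<rfloor> + nat \<lfloor>real N * a l\<rfloor> + 1" for l
  define H where "H b = H' (fst b)" for b :: "'i \<times> nat"
  \<comment> \<open>Truncated subtraction: if some branch already reaches \<open>N\<close>, then
    \<open>h = 0\<close>. In any case the maximal height plus \<open>h\<close> is at least
    \<open>N\<close>, and no branch plus \<open>h\<close> exceeds the larger of \<open>N\<close> and
    its own height.\<close>
  define h where "h = N - Max (H' ` I)"
  have I0: "I \<noteq> {}" using base_in_I by auto
  define R where "R = (\<Sum>b\<in>S. H b) + h + 1"
  \<comment> \<open>The numerator collects what leaf counts must outweigh: rounding in the
    \<open>M' l\<close>, which contributes \<open>m * card I\<close> in total and \<open>m\<close>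
    for one label, and the inner vertices, with factor 4 because \<open>2 * card nonleaves\<close>
    shall be at most half of \<open>\<delta> * V\<close>.\<close>
  obtain Q where "max 1 ((real m * real (card I) + real m + 4 * real R) / (real m * \<delta>)) \<le> real Q"
    using real_arch_simple by blast
  then have Q1: "1 \<le> real Q" and "(real m * real (card I) + real m + 4 * real R) / (real m * \<delta>) \<le> real Q"
    by auto
  then have Q: "real m * real (card I) + real m + 4 * real R \<le> \<delta> * (real m * real Q)"
    using m0 \<delta> by (simp add: field_simps)
  \<comment> \<open>The added 1 gives every branch a leaf, even if its label has tiny
    weight.\<close>
  define M' where "M' l = nat \<lfloor>w l * real Q\<rfloor> + 1" for l
  define M where "M b = M' (fst b)" for b :: "'i \<times> nat"
  have M': "w l * real Q \<le> real (M' l)" "real (M' l) \<le> w l * real Q + 1" if "l \<in> I" for l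
  proof -
    have "0 \<le> w l * real Q" using w_nonneg[OF that] by simp
    from floor_mult_bounds[OF this] show "w l * real Q \<le> real (M' l)" "real (M' l) \<le> w l * real Q + 1"
      unfolding M'_def of_nat_add of_nat_1 by linarith+
  qed
  have H'b: "real N * (e base l + a l) - 1 < real (H' l)" "real (H' l) \<le> real N * (e base l + a l) + 1" if "l \<in> I" for l
  proof -
    have "0 \<le> real N * e base l" "0 \<le> real N * a l"
      using e_nonneg[OF base_in_I that] a_nonneg[OF that] by simp_all
    from floor_mult_bounds[OF this(1)] floor_mult_bounds[OF this(2)]
    show "real N * (e base l + a l) - 1 < real (H' l)" "real (H' l) \<le> real N * (e base l + a l) + 1"
      unfolding H'_def of_nat_add of_nat_1 distrib_left by linarith+
  qed
  have \<gamma>b: "real N * gp (fst b) (fst c) - 1 < real (\<gamma> b c)" "real (\<gamma> b c) \<le> real N * gp (fst b) (fst c)"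
    if "b \<in> S" "c \<in> S" for b c
    using floor_mult_bounds[of "real N * gp (fst b) (fst c)"] gp_bounds[of "fst b" "fst c"] that
    by (auto simp: \<gamma>_def S_def)
  interpret bushy_tree S \<gamma> H M h
  proof
    show "finite S" using finite_I by (simp add: S_def)
    show "S \<noteq> {}" using base_in_I m0 by (auto simp: S_def)
    show "\<gamma> b c = \<gamma> c b" if "b \<in> S" "c \<in> S" for b c
      using that e_sym by (auto simp: \<gamma>_def gp_def S_def add.commute)
    show "\<gamma> b c < H b" if bc: "b \<in> S" "c \<in> S" for b c
    proof -
      have "real N * gp (fst b) (fst c) \<le> real N * e base (fst b)"
        using gp_bounds[of "fst b" "fst c"] bc by (intro mult_left_mono) (auto simp: S_def)
      then have "\<gamma> b c \<le> nat \<lfloor>real N * e base (fst b)\<rfloor>"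
        unfolding \<gamma>_def by (intro nat_mono floor_mono)
      then show ?thesis by (simp add: H_def H'_def)
    qed
    show "min (\<gamma> b c) (\<gamma> c c') \<le> \<gamma> b c'" if "b \<in> S" "c \<in> S" "c' \<in> S" for b c c'
    proof -
      have "min (gp (fst b) (fst c)) (gp (fst c) (fst c')) \<le> gp (fst b) (fst c')"
        unfolding gp_def using that by (intro e_ultra) (auto simp: S_def)
      then consider "gp (fst b) (fst c) \<le> gp (fst b) (fst c')" | "gp (fst c) (fst c') \<le> gp (fst b) (fst c')"
        by linarith
      then show ?thesis
      proof cases
        case 1
        then have "\<gamma> b c \<le> \<gamma> b c'" unfolding \<gamma>_def
          by (intro nat_mono floor_mono mult_left_mono) auto
        then show ?thesis by simp
      next
        case 2
        then have "\<gamma> c c' \<le> \<gamma> b c'" unfolding \<gamma>_def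
          by (intro nat_mono floor_mono mult_left_mono) auto
        then show ?thesis by simp
      qed
    qed
    show "0 < M b" if "b \<in> S" for b by (simp add: M_def M'_def)
  qed
  let ?V = "pverts graph"
  define D where "D = nat \<lfloor>real N * (1 + \<kappa>) + 4\<rfloor>"
  have ND: "real D \<le> real N * (1 + \<kappa>) + 4" using N0 \<kappa> floor_mult_bounds(2)[of "real N * (1 + \<kappa>) + 4"]
    by (simp add: D_def)
  have leD: "k \<le> D" if "real k \<le> real N * (1 + \<kappa>) + 4" for k
    using that unfolding D_def by (rule le_nat_floor)
  have H'_le: "real (H' l) \<le> real N * (1 + \<kappa>) + 1" if "l \<in> I" for l
  proof -
    have "e base l + a l \<le> 1 + \<kappa>" using bound[OF base_in_I that] a_nonneg[OF base_in_I] by simp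
    then have "real N * (e base l + a l) \<le> real N * (1 + \<kappa>)" by (intro mult_left_mono) auto
    then show ?thesis using H'b[OF that] by linarith
  qed
  have NN: "real N \<le> real N * (1 + \<kappa>)" using \<kappa> by (simp add: distrib_left)
  have distance_estimate: "\<bar>real (H b + H c - 2 * \<gamma> b c) - real N * (e (fst b) (fst c) + a (fst b) + a (fst c))\<bar> \<le> 4"
    and H\<gamma>: "real (H b) + real (H c) - 2 * real (\<gamma> b c) \<le> real N * (1 + \<kappa>) + 4"
    if bc: "b \<in> S" "c \<in> S" for b c
  proof -
    have i: "fst b \<in> I" "fst c \<in> I" using bc by (auto simp: S_def)
    have le: "2 * \<gamma> b c \<le> H b + H c" using \<gamma>_le[OF bc] \<gamma>_le[OF bc(2,1)] \<gamma>_sym[OF bc] by simp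
    \<comment> \<open>The distances to the root combine with the Gromov product to \<open>e\<close>.
      Each height is off by at most 1 and \<open>\<gamma>\<close>, counted twice, by less than 1,
      whence the bound 4.\<close>
    have eq: "real N * (e (fst b) (fst c) + a (fst b) + a (fst c))
        = real N * (e base (fst b) + a (fst b)) + real N * (e base (fst c) + a (fst c)) - 2 * (real N * gp (fst b) (fst c))"
      by (simp add: gp_def field_simps)
    have up: "\<bar>(real (H b) + real (H c) - 2 * real (\<gamma> b c)) - real N * (e (fst b) (fst c) + a (fst b) + a (fst c))\<bar> \<le> 4"
      unfolding eq using H'b[OF i(1)] H'b[OF i(2)] \<gamma>b[OF bc] unfolding H_def by linarith
    then show "\<bar>real (H b + H c - 2 * \<gamma> b c) - real N * (e (fst b) (fst c) + a (fst b) + a (fst c))\<bar> \<le> 4"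
      using le by (simp add: of_nat_diff)
    have "real N * (e (fst b) (fst c) + a (fst b) + a (fst c)) \<le> real N * (1 + \<kappa>)"
      using bound[OF i] by (intro mult_left_mono) auto
    then show "real (H b) + real (H c) - 2 * real (\<gamma> b c) \<le> real N * (1 + \<kappa>) + 4" using up by linarith
  qed
  have finH: "finite (H' ` I)" "H' ` I \<noteq> {}" using finite_I I0 by auto
  have diam_le: "graph_diam graph \<le> D"
  proof (rule graph_diam_le)
    show "2 \<le> D" using N2 NN by (intro leD) simp
    show "h \<le> D"
    proof (rule leD)
      have "real h \<le> real N" by (simp add: h_def)
      then show "real h \<le> real N * (1 + \<kappa>) + 4" using NN by linarith
    qed
    show "h + H b \<le> D" if "b \<in> S" for b
    proof (rule leD)
      have i: "fst b \<in> I" using that by (auto simp: S_def)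
      then have "H' (fst b) \<le> Max (H' ` I)" using finH by simp
      then have "h + H b \<le> max N (H b)" unfolding h_def H_def by simp
      then have "real (h + H b) \<le> max (real N) (real (H b))" by (metis of_nat_le_iff of_nat_max)
      then show "real (h + H b) \<le> real N * (1 + \<kappa>) + 4"
        using NN H'_le[OF i] unfolding H_def by linarith
    qed
    show "H b + H c \<le> D + 2 * \<gamma> b c" if "b \<in> S" "c \<in> S" for b c
    proof -
      have "H b + H c - 2 * \<gamma> b c \<le> D" using H\<gamma>[OF that] NN N0 by (intro leD) linarith
      then show ?thesis by simp
    qed
  qed
  have diam_ge: "N \<le> graph_diam graph"
  proof -
    obtain l where l: "l \<in> I" "Max (H' ` I) = H' l" using Max_in[OF finH] by auto
    have "N \<le> h + H (l, 0)" using l by (simp add: h_def H_def)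
    also have "\<dots> \<le> graph_diam graph" using l m0 by (intro graph_diam_ge) (auto simp: S_def)
    finally show ?thesis .
  qed
  define \<Delta> where "\<Delta> = real (graph_diam graph)"
  have \<Delta>: "real N \<le> \<Delta>" "\<Delta> \<le> real N * (1 + \<kappa>) + 4"
    using diam_le diam_ge ND by (auto simp: \<Delta>_def)
  \<comment> \<open>Inner vertices get the label \<open>base\<close> by default; they are too few to
    matter.\<close>
  define t where "t v = (if v \<in> leaf ` leaf_index then fst (branch_of v) else base)" for v
  have branch: "branch_of v \<in> S" if "v \<in> leaf ` leaf_index" for v
    using that by (auto simp: branch_of_leaf leaf_index_def)
  have t_I: "t v \<in> I" for v using branch[of v] base_in_I by (auto simp: t_def S_def)
  have good: "\<bar>tree_dist graph u v - (e (t u) (t v) + a (t u) + a (t v))\<bar> \<le> 3 * \<kappa>"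
    if uv: "u \<in> ?V" "v \<in> ?V" "u \<notin> nonleaves" "v \<notin> nonleaves" "branch_of u \<noteq> branch_of v" for u v
  proof -
    obtain x y where xy: "u = leaf x" "v = leaf y" "x \<in> leaf_index" "y \<in> leaf_index"
      using uv by (auto simp: nonleaves_def)
    then have ne: "fst x \<noteq> fst y" using uv by (auto simp: branch_of_leaf)
    have S: "fst x \<in> S" "fst y \<in> S" using xy by (auto simp: leaf_index_def)
    define d where "d = e (t u) (t v) + a (t u) + a (t v)"
    have tt: "t u = fst (fst x)" "t v = fst (fst y)" using xy by (auto simp: t_def branch_of_leaf)
    have d: "0 \<le> d" "d \<le> 1 + \<kappa>"
      using bound[OF t_I t_I] e_nonneg[OF t_I t_I] a_nonneg[OF t_I] by (auto simp: d_def)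
    have near: "\<bar>real (graph_dist graph u v) - real N * d\<bar> \<le> 4"
      unfolding d_def tt unfolding xy(1,2) graph_dist_leaves[OF xy(3,4) ne]
      by (rule distance_estimate[OF S])
    \<comment> \<open>Normalizing by the true diameter \<open>\<Delta>\<close> in place of
      \<open>N\<close> costs \<open>(\<Delta> - N) * d\<close>, where
      \<open>d \<le> 1 + \<kappa> \<le> 2\<close>.\<close>
    have "(\<Delta> - real N) * d \<le> (real N * \<kappa> + 4) * 2"
      using \<Delta> d \<kappa> N0 by (intro mult_mono) (auto simp: distrib_left)
    then have up: "\<Delta> * d - real N * d \<le> 2 * (real N * \<kappa>) + 8" by (simp add: left_diff_distrib)
    have lo: "0 \<le> \<Delta> * d - real N * d" using \<Delta>(1) d(1) mult_right_mono[of "real N" \<Delta> d] by simp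
    have "\<bar>real (graph_dist graph u v) - \<Delta> * d\<bar> \<le> 2 * (real N * \<kappa>) + 12"
      using near up lo unfolding abs_le_iff by simp
    also have "12 \<le> real N * \<kappa>" using N\<kappa> \<kappa> by (simp add: field_simps)
    finally have "\<bar>real (graph_dist graph u v) - \<Delta> * d\<bar> \<le> 3 * \<kappa> * real N" by simp
    also have "\<dots> \<le> 3 * \<kappa> * \<Delta>" using \<Delta> \<kappa> by simp
    finally have "\<bar>real (graph_dist graph u v) - \<Delta> * d\<bar> / \<Delta> \<le> 3 * \<kappa>"
      using \<Delta> N0 by (simp add: divide_le_eq)
    also have "\<bar>real (graph_dist graph u v) - \<Delta> * d\<bar> / \<Delta> = \<bar>tree_dist graph u v - d\<bar>"
    proof -
      have "tree_dist graph u v - d = (real (graph_dist graph u v) - \<Delta> * d) / \<Delta>"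
        using \<Delta> N0 by (simp add: tree_dist_def \<Delta>_def[symmetric] diff_divide_distrib)
      then show ?thesis using \<Delta> N0 by (simp add: abs_divide)
    qed
    finally show ?thesis by (simp add: d_def)
  qed
  have cardR: "real (card nonleaves) \<le> real R"
    using card_nonleaves unfolding nonleaves_def R_def by (intro of_nat_mono)
  have sumM: "real (\<Sum>b\<in>S. M b) = real m * (\<Sum>l\<in>I. real (M' l))"
    unfolding S_def M_def sum.cartesian_product' by (simp add: sum_distrib_left sum.distrib mult.commute)
  define V where "V = real (card ?V)"
  have V_eq: "V = real m * (\<Sum>l\<in>I. real (M' l)) + real (card nonleaves)"
    unfolding V_def card_verts using sumM by simp
  have M'_sum: "real Q \<le> (\<Sum>l\<in>I. real (M' l))" "(\<Sum>l\<in>I. real (M' l)) \<le> real Q + real (card I)"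
  proof -
    have s: "(\<Sum>l\<in>I. w l * real Q) = real Q" using w_sum by (simp add: sum_distrib_right[symmetric])
    have "(\<Sum>l\<in>I. w l * real Q) \<le> (\<Sum>l\<in>I. real (M' l))" using M' by (intro sum_mono)
    then show "real Q \<le> (\<Sum>l\<in>I. real (M' l))" by (simp add: s)
    have "(\<Sum>l\<in>I. real (M' l)) \<le> (\<Sum>l\<in>I. w l * real Q + 1)" using M' by (intro sum_mono)
    then show "(\<Sum>l\<in>I. real (M' l)) \<le> real Q + real (card I)" by (simp add: sum.distrib s)
  qed
  have V_ge: "real m * real Q \<le> V"
    using mult_left_mono[OF M'_sum(1), of "real m"] by (simp add: V_eq)
  have V_le: "V \<le> real m * real Q + real m * real (card I) + real R"
    using mult_left_mono[OF M'_sum(2), of "real m"] cardR by (simp add: V_eq distrib_left)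
  have V0: "0 < V" using V_ge m0 Q1 by (smt (verit) mult_pos_pos of_nat_0_less_iff)
  have \<delta>V: "real m * real (card I) + real m + 4 * real R \<le> \<delta> * V"
    using Q mult_left_mono[OF V_ge, of \<delta>] \<delta> by linarith
  have freq: "\<bar>real (card {v \<in> ?V. t v = l}) / real (card ?V) - w l\<bar> \<le> \<delta>" if l: "l \<in> I" for l
  proof -
    let ?A = "{v \<in> leaf ` leaf_index. branch_of v \<in> {l} \<times> {..<m}}"
    have B: "{l} \<times> {..<m} \<subseteq> S" using l by (auto simp: S_def)
    have cA: "real (card ?A) = real m * real (M' l)"
      unfolding card_leaves_of[OF B] by (simp add: M_def sum.cartesian_product')
    have t_iff: "t v = l \<longleftrightarrow> branch_of v \<in> {l} \<times> {..<m}" if "v \<in> leaf ` leaf_index" for v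
      using that branch[OF that] by (auto simp: t_def S_def)
    have sub: "?A \<subseteq> {v \<in> ?V. t v = l}" "{v \<in> ?V. t v = l} \<subseteq> ?A \<union> nonleaves"
      using t_iff leaf_in_verts by (auto simp: nonleaves_def)
    have "card ?A \<le> card {v \<in> ?V. t v = l}" using finite_graph_verts by (intro card_mono sub) auto
    moreover have "card {v \<in> ?V. t v = l} \<le> card ?A + card nonleaves"
      by (rule order_trans[OF card_mono[OF _ sub(2)] card_Un_le])
        (use finite_graph_verts finite_leaf_index in \<open>auto simp: nonleaves_def\<close>)
    ultimately have "real (card ?A) \<le> real (card {v \<in> ?V. t v = l})"
      "real (card {v \<in> ?V. t v = l}) \<le> real (card ?A) + real (card nonleaves)" by linarith+
    then have c: "real m * real (M' l) \<le> real (card {v \<in> ?V. t v = l})"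
      "real (card {v \<in> ?V. t v = l}) \<le> real m * real (M' l) + real R" using cA cardR by linarith+
    have w1: "w l \<le> 1" using member_le_sum[of l I w] l finite_I w_nonneg w_sum by auto
    have "w l * V \<le> w l * (real m * real Q) + 1 * (real m * real (card I) + real R)"
      using mult_left_mono[OF V_le w_nonneg[OF l]]
        mult_right_mono[OF w1, of "real m * real (card I) + real R"] by (simp add: distrib_left)
    moreover have "real m * (w l * real Q) \<le> real m * real (M' l)"
      "real m * real (M' l) \<le> real m * (w l * real Q + 1)" using M'[OF l] by (intro mult_left_mono; simp)+
    moreover have "w l * (real m * real Q) \<le> w l * V" using mult_left_mono[OF V_ge w_nonneg[OF l]] .
    ultimately have "\<bar>real (card {v \<in> ?V. t v = l}) - w l * V\<bar> \<le> \<delta> * V"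
      using c \<delta>V by (simp add: abs_le_iff algebra_simps)
    then have "\<bar>real (card {v \<in> ?V. t v = l}) - w l * V\<bar> / V \<le> \<delta>" using V0 by (simp add: divide_le_eq)
    also have "\<bar>real (card {v \<in> ?V. t v = l}) - w l * V\<bar> / V = \<bar>real (card {v \<in> ?V. t v = l}) / V - w l\<bar>"
    proof -
      have "real (card {v \<in> ?V. t v = l}) / V - w l = (real (card {v \<in> ?V. t v = l}) - w l * V) / V"
        using V0 by (simp add: diff_divide_distrib)
      then show ?thesis using V0 by (simp add: abs_divide)
    qed
    finally show ?thesis by (simp add: V_def)
  qed
  have bad: "real (card {(u, v) \<in> ?V \<times> ?V.
       \<not> \<bar>tree_dist graph u v - (e (t u) (t v) + a (t u) + a (t v))\<bar> \<le> 3 * \<kappa>}) \<le> \<delta> * real (card ?V) ^ 2"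
  proof -
    let ?B = "{(u, v) \<in> ?V \<times> ?V. \<not> \<bar>tree_dist graph u v - (e (t u) (t v) + a (t u) + a (t v))\<bar> \<le> 3 * \<kappa>}"
    let ?C = "{(u, v) \<in> ?V \<times> ?V. u \<in> nonleaves \<or> v \<in> nonleaves \<or> branch_of u = branch_of v}"
    have "?B \<subseteq> ?C" using good by blast
    moreover have "finite ?C" by (rule finite_subset[of _ "?V \<times> ?V"]) (use finite_graph_verts in auto)
    ultimately have "card ?B \<le> 2 * card nonleaves * card ?V + (\<Sum>b\<in>S. M b * M b)"
      using card_mono card_bad_pairs order_trans by blast
    then have "real (card ?B) \<le> real (2 * card nonleaves * card ?V + (\<Sum>b\<in>S. M b * M b))"
      by (rule of_nat_mono)
    also have "\<dots> = 2 * real (card nonleaves) * V + (\<Sum>b\<in>S. real (M b) * real (M b))"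
      by (simp add: V_def)
    \<comment> \<open>All \<open>m\<close> branches of a label have equally many leaves, so no
      branch holds more than \<open>V / m\<close> of them.\<close>
    also have "(\<Sum>b\<in>S. real (M b) * real (M b)) \<le> (\<Sum>b\<in>S. real (M b) * (V / real m))"
    proof (intro sum_mono mult_left_mono)
      fix b assume "b \<in> S"
      then have "fst b \<in> I" by (auto simp: S_def)
      then have "real (M b) \<le> (\<Sum>l\<in>I. real (M' l))"
        unfolding M_def using finite_I by (intro member_le_sum) auto
      then have "real m * real (M b) \<le> V" unfolding V_eq
        by (smt (verit) mult_left_mono of_nat_0_le_iff)
      then show "real (M b) \<le> V / real m" using m0 by (simp add: field_simps)
    qed simp
    also have "\<dots> = real (\<Sum>b\<in>S. M b) * (V / real m)" by (simp only: of_nat_sum sum_distrib_right)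
    also have "\<dots> \<le> V * (V / real m)"
      using V0 m0 by (intro mult_right_mono) (auto simp: V_def card_verts)
    also have "\<dots> \<le> V * (V * (\<delta> / 2))"
    proof -
      have "1 / real m \<le> \<delta> / 2" using m m0 \<delta> by (simp add: field_simps)
      then have "V * (1 / real m) \<le> V * (\<delta> / 2)" using V0 by (intro mult_left_mono) auto
      then show ?thesis using V0 by (intro mult_left_mono) auto
    qed
    also have "2 * real (card nonleaves) * V \<le> (\<delta> / 2 * V) * V"
    proof (intro mult_right_mono)
      have "4 * real R \<le> \<delta> * V" using \<delta>V by (smt (verit) mult_nonneg_nonneg of_nat_0_le_iff)
      then show "2 * real (card nonleaves) \<le> \<delta> / 2 * V" using cardR by linarith
    qed (use V0 in simp)
    finally show ?thesis by (simp add: V_def power2_eq_square algebra_simps)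
  qed
  show thesis
  proof (rule that[of graph t])
    show "t \<in> ?V \<rightarrow> I" using t_I by auto
    show "\<forall>u\<in>?V. \<forall>v\<in>?V. tree_dist graph u v \<in> {0..1}"
      using graph_dist_le_diam \<Delta> N0 by (simp add: tree_dist_def \<Delta>_def divide_le_eq)
    show "\<forall>l\<in>I. \<bar>real (card {v \<in> ?V. t v = l}) / real (card ?V) - w l\<bar> \<le> \<delta>"
      using freq by simp
  qed (fact nontrivial_finite_tree_graph finite_graph_verts bad)+
qed

end

section \<open>Discretization of dendrons\<close>

lemma pair_uniform_count_measure:
  assumes "finite A" "A \<noteq> {}"
  shows "uniform_count_measure A \<Otimes>\<^sub>M uniform_count_measure A = uniform_count_measure (A \<times> A)"
proof (rule pair_measure_eqI)
  interpret prob_space "uniform_count_measure A" by (rule prob_space_uniform_count_measure[OF assms])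
  show "sigma_finite_measure (uniform_count_measure A)" "sigma_finite_measure (uniform_count_measure A)"
    by unfold_locales
  have "sets (uniform_count_measure A \<Otimes>\<^sub>M uniform_count_measure A) = sets (count_space A \<Otimes>\<^sub>M count_space A)"
    by (intro sets_pair_measure_cong sets_uniform_count_measure_count_space)
  then show "sets (uniform_count_measure A \<Otimes>\<^sub>M uniform_count_measure A) = sets (uniform_count_measure (A \<times> A))"
    unfolding pair_measure_count_space[OF assms(1,1)] sets_uniform_count_measure by simp
  fix X Y assume "X \<in> sets (uniform_count_measure A)" "Y \<in> sets (uniform_count_measure A)"
  then have XY: "X \<subseteq> A" "Y \<subseteq> A" by (auto simp: sets_uniform_count_measure)
  then have "X \<times> Y \<subseteq> A \<times> A" by blast
  then show "emeasure (uniform_count_measure A) X * emeasure (uniform_count_measure A) Y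
     = emeasure (uniform_count_measure (A \<times> A)) (X \<times> Y)"
    unfolding emeasure_uniform_count_measure[OF assms(1) XY(1)] emeasure_uniform_count_measure[OF assms(1) XY(2)]
      emeasure_uniform_count_measure[OF finite_cartesian_product[OF assms(1,1)] \<open>X \<times> Y \<subseteq> A \<times> A\<close>]
    by (subst ennreal_mult[symmetric]) (auto simp: card_cartesian_product)
qed

lemma measurable_uniform_count_pair:
  assumes "finite A" "A \<noteq> {}"
  shows "case_prod (D :: _ \<Rightarrow> _ \<Rightarrow> real) \<in> borel_measurable (uniform_count_measure A \<Otimes>\<^sub>M uniform_count_measure A)"
  unfolding pair_uniform_count_measure[OF assms]
    measurable_cong_sets[OF sets_uniform_count_measure_count_space refl] by simp

lemma continuous_map_borel_measurable_cong:
  assumes "sets \<nu> = sets (borel_of X)" "continuous_map X euclideanreal f"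
  shows "f \<in> borel_measurable \<nu>"
  unfolding measurable_cong_sets[OF assms(1) refl] by (rule continuous_map_borel_measurable[OF assms(2)])

section \<open>Measurability and finite partitions of a long dendron\<close>

locale long_dendron_space =
  fixes T :: "'a metric" and \<nu> :: "('a \<times> real) measure"
  assumes long_dendron: "long_dendron T \<nu>"
begin

sublocale real_tree_space T
  using long_dendron by unfold_locales (simp add: long_dendron_def)

sublocale prob_space \<nu>
  using long_dendron by (simp add: long_dendron_def Prob_def)

lemma sets_\<nu>: "sets \<nu> = sets (borel_of (dendron_space T))"
  using long_dendron by (simp add: long_dendron_def Prob_def)

lemma space_\<nu>: "space \<nu> = X \<times> {0..}"
  using sets_eq_imp_space_eq[OF sets_\<nu>] by (simp add: dendron_space_def)

lemma measurable_dist_to_point: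
  assumes "z \<in> X"
  shows "(\<lambda>x. d (fst x) z) \<in> borel_measurable \<nu>"
proof (rule continuous_map_borel_measurable_cong[OF sets_\<nu>])
  show "continuous_map (dendron_space T) euclideanreal (\<lambda>x. d (fst x) z)"
    unfolding dendron_space_def
    using assms by (intro continuous_map_mdist continuous_map_fst) simp
qed

lemma measurable_height: "snd \<in> borel_measurable \<nu>"
proof (rule continuous_map_borel_measurable_cong[OF sets_\<nu>])
  show "continuous_map (dendron_space T) euclideanreal snd"
    unfolding dendron_space_def
    by (rule continuous_map_into_fulltopology[OF continuous_map_snd])
qed

lemma separable: "\<exists>Z. countable Z \<and> Z \<subseteq> X \<and> (\<forall>x\<in>X. \<forall>\<epsilon>>0. \<exists>z\<in>Z. d x z < \<epsilon>)"
proof (rule ex_countable_dense)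
  show "finite_measure \<nu>" by unfold_locales
  show "0 < emeasure \<nu> (B \<times> {0..})" if "branch T B" for B
    using long_dendron that by (simp add: long_dendron_def)
qed

text \<open>The distance of \<open>u\<close> and \<open>v\<close> is the infimum of
  \<open>d u z + d v z\<close> over a countable dense set of \<open>z\<close>, and each summand is
  continuous in one coordinate alone. Joint continuity of \<open>d\<close> by itself would only
  concern the Borel sets of the product space.\<close>

lemma measurable_dendron_dist: "case_prod (dendron_dist T) \<in> borel_measurable (\<nu> \<Otimes>\<^sub>M \<nu>)"
proof -
  obtain Z where Z: "countable Z" "Z \<subseteq> X" and "\<forall>x\<in>X. \<forall>\<epsilon>>0. \<exists>z\<in>Z. d x z < \<epsilon>"
    using separable by (elim exE conjE)
  then have dense: "\<exists>z\<in>Z. d x z < \<epsilon>" if "x \<in> X" "0 < \<epsilon>" for x \<epsilon> using that by simp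
  define F where "F z p = d (fst (fst p)) z + d (fst (snd p)) z + snd (fst p) + snd (snd p)"
    for z and p :: "('a \<times> real) \<times> 'a \<times> real"
  have F: "F z \<in> borel_measurable (\<nu> \<Otimes>\<^sub>M \<nu>)" if "z \<in> Z" for z
  proof -
    have z: "z \<in> X" using that Z by blast
    show ?thesis unfolding F_def
      using measurable_compose[OF measurable_fst measurable_dist_to_point[OF z], of \<nu>]
        measurable_compose[OF measurable_snd measurable_dist_to_point[OF z], of \<nu>]
        measurable_compose[OF measurable_fst measurable_height, of \<nu>]
        measurable_compose[OF measurable_snd measurable_height, of \<nu>]
      by (intro borel_measurable_add)
  qed
  show ?thesis
    unfolding borel_measurable_iff_less
  proof
    fix c :: real
    have "{p \<in> space (\<nu> \<Otimes>\<^sub>M \<nu>). case_prod (dendron_dist T) p < c}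
        = (\<Union>z\<in>Z. {p \<in> space (\<nu> \<Otimes>\<^sub>M \<nu>). F z p < c})"
    proof (intro set_eqI iffI)
      fix p assume p: "p \<in> {p \<in> space (\<nu> \<Otimes>\<^sub>M \<nu>). case_prod (dendron_dist T) p < c}"
      obtain u a v b where uv: "p = ((u, a), (v, b))" by (metis surj_pair)
      have X: "u \<in> X" "v \<in> X" using p uv by (auto simp: space_pair_measure space_\<nu>)
      have lt: "d u v + a + b < c" using p uv by (simp add: dendron_dist_def)
      \<comment> \<open>Half of the gap, because a detour through \<open>z\<close> lengthens the way
        by up to \<open>2 * d u z\<close>.\<close>
      then have "0 < (c - (d u v + a + b)) / 2" by simp
      from dense[OF X(1) this] obtain z where z: "z \<in> Z" "d u z < (c - (d u v + a + b)) / 2"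
        by (rule bexE)
      have zX: "z \<in> X" using z Z by blast
      have "d v z \<le> d u v + d u z" using triangle[OF X(2,1) zX] commute[of v u] by simp
      then have "F z p < c" using z(2) uv by (simp add: F_def)
      then show "p \<in> (\<Union>z\<in>Z. {p \<in> space (\<nu> \<Otimes>\<^sub>M \<nu>). F z p < c})" using z p by blast
    next
      fix p assume "p \<in> (\<Union>z\<in>Z. {p \<in> space (\<nu> \<Otimes>\<^sub>M \<nu>). F z p < c})"
      then obtain z where z: "z \<in> Z" "p \<in> space (\<nu> \<Otimes>\<^sub>M \<nu>)" "F z p < c" by blast
      obtain u a v b where uv: "p = ((u, a), (v, b))" by (metis surj_pair)
      have X: "u \<in> X" "v \<in> X" "z \<in> X" using z uv Z by (auto simp: space_pair_measure space_\<nu>)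
      have "d u v \<le> d u z + d v z" using triangle[OF X(1,3,2)] commute[of v z] by simp
      then show "p \<in> {p \<in> space (\<nu> \<Otimes>\<^sub>M \<nu>). case_prod (dendron_dist T) p < c}"
        using z uv by (simp add: F_def dendron_dist_def)
    qed
    also have "\<dots> \<in> sets (\<nu> \<Otimes>\<^sub>M \<nu>)"
      using F by (intro sets.countable_UN'' Z(1) borel_measurable_less borel_measurable_const) auto
    finally show "{p \<in> space (\<nu> \<Otimes>\<^sub>M \<nu>). case_prod (dendron_dist T) p < c} \<in> sets (\<nu> \<Otimes>\<^sub>M \<nu>)" .
  qed
qed

lemma dendron_dist_perturb:
  assumes "x \<in> space \<nu>" "x' \<in> space \<nu>" "y \<in> space \<nu>" "y' \<in> space \<nu>"
    and "d (fst x) (fst x') \<le> \<epsilon>" "\<bar>snd x - snd x'\<bar> \<le> \<epsilon>"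
    and "d (fst y) (fst y') \<le> \<epsilon>" "\<bar>snd y - snd y'\<bar> \<le> \<epsilon>"
  shows "\<bar>dendron_dist T x y - dendron_dist T x' y'\<bar> \<le> 4 * \<epsilon>"
proof -
  have X: "fst x \<in> X" "fst x' \<in> X" "fst y \<in> X" "fst y' \<in> X"
    using assms by (auto simp: space_\<nu>)
  have "d (fst x) (fst y) \<le> d (fst x) (fst x') + d (fst x') (fst y') + d (fst y') (fst y)"
    using triangle[OF X(1,2,3)] triangle[OF X(2,4,3)] by simp
  moreover have "d (fst x') (fst y') \<le> d (fst x') (fst x) + d (fst x) (fst y) + d (fst y) (fst y')"
    using triangle[OF X(2,1,4)] triangle[OF X(1,3,4)] by simp
  ultimately have "\<bar>d (fst x) (fst y) - d (fst x') (fst y')\<bar> \<le> 2 * \<epsilon>"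
    using assms(5,7) commute[of "fst x'" "fst x"] commute[of "fst y'" "fst y"] by (simp add: abs_le_iff)
  then show ?thesis using assms(6,8) unfolding dendron_dist_def split_beta by linarith
qed

text \<open>Products of \<open>\<epsilon>\<close>-balls and \<open>\<epsilon>\<close>-intervals
  around a countable grid are made disjoint, and finitely many of them carry mass
  \<open>1 - \<epsilon>\<close>. Null pieces are dropped, since only positive measure controls the
  mutual distances of representatives. A representative \<open>p k\<close> is the centre of the
  original set and may lie outside its piece.\<close>

lemma ex_finite_partition:
  assumes \<epsilon>: "0 < \<epsilon>" "\<epsilon> < 1"
  obtains I :: "nat set" and E p where "finite I" "I \<noteq> {}" "disjoint_family_on E I"
    "\<forall>k\<in>I. E k \<in> sets \<nu> \<and> 0 < emeasure \<nu> (E k) \<and> p k \<in> space \<nu>"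
    "\<forall>k\<in>I. \<forall>x\<in>E k. d (fst x) (fst (p k)) \<le> \<epsilon> \<and> \<bar>snd x - snd (p k)\<bar> \<le> \<epsilon>"
    "prob (space \<nu> - (\<Union>k\<in>I. E k)) \<le> \<epsilon>"
proof -
  obtain Z where Z: "countable Z" "Z \<subseteq> X" and "\<forall>x\<in>X. \<forall>\<epsilon>>0. \<exists>z\<in>Z. d x z < \<epsilon>"
    using separable by (elim exE conjE)
  then have dense: "\<exists>z\<in>Z. d x z < \<epsilon>" if "x \<in> X" "0 < \<epsilon>" for x \<epsilon> using that by simp
  define P where "P = Z \<times> range (\<lambda>n. real n * \<epsilon>)"
  have cP: "countable P" unfolding P_def using Z by (intro countable_SIGMA) auto
  have P_sub: "P \<subseteq> space \<nu>" using Z \<epsilon> by (auto simp: P_def space_\<nu>)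
  have P_near: "\<exists>q\<in>P. d (fst x) (fst q) \<le> \<epsilon> \<and> \<bar>snd x - snd q\<bar> \<le> \<epsilon>" if "x \<in> space \<nu>" for x
  proof -
    have x: "fst x \<in> X" "0 \<le> snd x" using that by (auto simp: space_\<nu>)
    obtain z where z: "z \<in> Z" "d (fst x) z < \<epsilon>" using dense[OF x(1) \<epsilon>(1)] by blast
    define n where "n = nat \<lfloor>snd x / \<epsilon>\<rfloor>"
    have "0 \<le> snd x / \<epsilon>" using x \<epsilon> by simp
    then have "real n \<le> snd x / \<epsilon>" "snd x / \<epsilon> < real n + 1" unfolding n_def by linarith+
    then have "real n * \<epsilon> \<le> snd x" "snd x < real n * \<epsilon> + \<epsilon>" using \<epsilon> by (simp_all add: field_simps)
    then show ?thesis using z by (intro bexI[of _ "(z, real n * \<epsilon>)"]) (auto simp: P_def)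
  qed
  have "space \<nu> \<noteq> {}" by (rule not_empty)
  then have "P \<noteq> {}" using P_near by blast
  define p where "p = from_nat_into P"
  have p_P: "p k \<in> P" for k unfolding p_def by (rule from_nat_into[OF \<open>P \<noteq> {}\<close>])
  then have p_space: "p k \<in> space \<nu>" for k using P_sub by blast
  define C where "C k = {x \<in> space \<nu>. d (fst x) (fst (p k)) \<le> \<epsilon> \<and> \<bar>snd x - snd (p k)\<bar> \<le> \<epsilon>}" for k
  have C: "C k \<in> sets \<nu>" for k
  proof -
    have [measurable]: "(\<lambda>x. d (fst x) (fst (p k))) \<in> borel_measurable \<nu>"
      using p_space[of k] by (intro measurable_dist_to_point) (auto simp: space_\<nu>)
    have [measurable]: "snd \<in> borel_measurable \<nu>" by (rule measurable_height)
    show ?thesis unfolding C_def by measurable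
  qed
  have cover: "(\<Union>k. C k) = space \<nu>"
  proof
    show "space \<nu> \<subseteq> (\<Union>k. C k)"
    proof
      fix x assume x: "x \<in> space \<nu>"
      then obtain q where q: "q \<in> P" "d (fst x) (fst q) \<le> \<epsilon> \<and> \<bar>snd x - snd q\<bar> \<le> \<epsilon>" using P_near by blast
      have "p (to_nat_on P q) = q" unfolding p_def by (rule from_nat_into_to_nat_on[OF cP q(1)])
      with x q have "x \<in> C (to_nat_on P q)" by (simp add: C_def)
      then show "x \<in> (\<Union>k. C k)" by blast
    qed
  qed (auto simp: C_def)
  define E where "E = disjointed C"
  have E: "E k \<in> sets \<nu>" for k
    unfolding E_def using C by (intro sets.range_disjointed_sets[THEN subsetD, of C]) auto
  have E_sub: "E k \<subseteq> C k" for k unfolding E_def by (rule disjointed_subset)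
  have E_disj: "disjoint_family E" unfolding E_def by (rule disjoint_family_disjointed)
  have E_UN: "(\<Union>k. E k) = space \<nu>" unfolding E_def UN_disjointed_eq by (rule cover)
  have "(\<lambda>k. prob (E k)) sums prob (\<Union>k. E k)"
    using E E_disj by (intro finite_measure_UNION) auto
  then have "(\<lambda>n. \<Sum>k<n. prob (E k)) \<longlonglongrightarrow> 1"
    by (simp add: E_UN prob_space sums_def)
  then have "\<forall>\<^sub>F n in sequentially. 1 - \<epsilon> < (\<Sum>k<n. prob (E k))"
    using \<epsilon> by (intro order_tendstoD) auto
  then obtain K where K: "1 - \<epsilon> < (\<Sum>k<K. prob (E k))" by (auto simp: eventually_sequentially)
  define I where "I = {k. k < K \<and> 0 < prob (E k)}"
  have fI: "finite I" unfolding I_def by simp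
  have "(\<Sum>k\<in>I. prob (E k)) = (\<Sum>k<K. prob (E k))"
    using zero_less_measure_iff by (intro sum.mono_neutral_left) (auto simp: I_def)
  moreover have "prob (\<Union>k\<in>I. E k) = (\<Sum>k\<in>I. prob (E k))"
    using fI E disjoint_family_on_mono[OF _ E_disj, of I] by (intro finite_measure_finite_Union) auto
  ultimately have PI: "1 - \<epsilon> < prob (\<Union>k\<in>I. E k)" using K by simp
  show thesis
  proof (rule that[of I E p])
    show "I \<noteq> {}" using PI \<epsilon> by auto
    show "disjoint_family_on E I" using disjoint_family_on_mono[OF _ E_disj] by blast
    show "\<forall>k\<in>I. E k \<in> sets \<nu> \<and> 0 < emeasure \<nu> (E k) \<and> p k \<in> space \<nu>"
      using E p_space by (simp add: I_def emeasure_eq_measure)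
    show "\<forall>k\<in>I. \<forall>x\<in>E k. d (fst x) (fst (p k)) \<le> \<epsilon> \<and> \<bar>snd x - snd (p k)\<bar> \<le> \<epsilon>"
      using E_sub unfolding C_def by blast
    have "(\<Union>k\<in>I. E k) \<in> sets \<nu>" using fI E by auto
    then show "prob (space \<nu> - (\<Union>k\<in>I. E k)) \<le> \<epsilon>" using PI by (simp add: prob_compl)
  qed (rule fI)
qed

end

section \<open>Comparison of a dendron with one finite tree\<close>

context long_dendron_space
begin

text \<open>The tree is chosen before \<open>r \<le> n\<close> and \<open>f\<close>. The error is
  that of three comparisons: dendron with labels of pieces, labels of pieces with labels of
  vertices, labels of vertices with tree. The outer two cost \<open>\<eta>\<close> each and together
  \<open>6 * r^2 * B * \<epsilon>\<close>, from bad sets of measure \<open>2 * \<epsilon>\<close>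
  and \<open>\<epsilon>\<close>; the middle one costs \<open>B * \<epsilon>\<close>. The scale
  \<open>12 * \<epsilon>\<close> is \<open>3 * \<kappa>\<close> for
  \<open>\<kappa> = 4 * \<epsilon>\<close>.\<close>

lemma ex_tree_approximation:
  assumes null: "emeasure (\<nu> \<Otimes>\<^sub>M \<nu>) {(x, y). x \<in> mspace T \<times> {0..} \<and> y \<in> mspace T \<times> {0..} \<and>
       dendron_dist T x y > 1} = 0"
    and \<epsilon>: "0 < \<epsilon>" "4 * \<epsilon> \<le> 1"
  shows "\<exists>G :: nat pair_pre_digraph. nontrivial_finite_tree G \<and> finite (pverts G) \<and>
    (\<forall>r f B \<eta>. r \<le> n \<and> continuous_map (matrix_space r) euclideanreal f \<and>
        (\<forall>A\<in>topspace (matrix_space r). \<bar>f A\<bar> \<le> B) \<and> 0 \<le> \<eta> \<and> matrix_modulus r f 2 (12 * \<epsilon>) \<eta> \<longrightarrow>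
        \<bar>(\<integral>A. f A \<partial>tree_sampling_measure r G) - (\<integral>A. f A \<partial>dendron_sampling_measure r T \<nu>)\<bar>
          \<le> 2 * \<eta> + (6 * real r ^ 2 + 1) * B * \<epsilon>)"
proof -
  obtain I :: "nat set" and E p where I: "finite I" "I \<noteq> {}" and disj: "disjoint_family_on E I"
    and Ep: "\<forall>k\<in>I. E k \<in> sets \<nu> \<and> 0 < emeasure \<nu> (E k) \<and> p k \<in> space \<nu>"
    and near: "\<forall>k\<in>I. \<forall>x\<in>E k. d (fst x) (fst (p k)) \<le> \<epsilon> \<and> \<bar>snd x - snd (p k)\<bar> \<le> \<epsilon>"
    and rest: "prob (space \<nu> - (\<Union>k\<in>I. E k)) \<le> \<epsilon>"
    by (rule ex_finite_partition[of \<epsilon>]) (use \<epsilon> in auto)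
  obtain base where base: "base \<in> I" using I by blast
  define N0 where "N0 = space \<nu> - (\<Union>k\<in>I. E k)"
  have N0: "N0 \<in> sets \<nu>" unfolding N0_def using I Ep by auto
  have E_space: "E k \<subseteq> space \<nu>" if "k \<in> I" for k using Ep that sets.sets_into_space by blast
  define s where "s x = (if x \<in> N0 then base else (THE k. k \<in> I \<and> x \<in> E k))" for x
  have s_E: "s x = k" if "k \<in> I" "x \<in> E k" for x k
  proof -
    have "(THE k. k \<in> I \<and> x \<in> E k) = k"
      using that disj by (intro the_equality) (auto simp: disjoint_family_on_def)
    moreover have "x \<notin> N0" using that by (auto simp: N0_def)
    ultimately show ?thesis by (simp add: s_def)
  qed
  have s_I: "s x \<in> I \<and> x \<in> E (s x)" if "x \<in> space \<nu>" "x \<notin> N0" for x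
  proof -
    obtain k where "k \<in> I" "x \<in> E k" using \<open>x \<in> space \<nu>\<close> \<open>x \<notin> N0\<close> by (auto simp: N0_def)
    then show ?thesis using s_E by auto
  qed
  have s_vimage: "s -` {k} \<inter> space \<nu> = E k \<union> (if k = base then N0 else {})" if k: "k \<in> I" for k
  proof (intro set_eqI iffI)
    fix x assume x: "x \<in> s -` {k} \<inter> space \<nu>"
    show "x \<in> E k \<union> (if k = base then N0 else {})"
    proof (cases "x \<in> N0")
      case True
      then show ?thesis using x by (auto simp: s_def)
    next
      case False
      then show ?thesis using s_I[of x] x by auto
    qed
  next
    fix x assume "x \<in> E k \<union> (if k = base then N0 else {})"
    then consider "x \<in> E k" | "k = base" "x \<in> N0" by (auto split: if_splits)
    then show "x \<in> s -` {k} \<inter> space \<nu>"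
    proof cases
      case 1
      then show ?thesis using s_E[OF k 1] E_space[OF k] by auto
    next
      case 2
      then show ?thesis by (auto simp: s_def N0_def)
    qed
  qed
  have s_range: "s x \<in> I" if "x \<in> space \<nu>" for x
    using s_I[OF that] base by (cases "x \<in> N0") (auto simp: s_def)
  have s_vimage_sets: "s -` {k} \<inter> space \<nu> \<in> sets \<nu>" if "k \<in> I" for k
    using s_vimage[OF that] Ep N0 that by auto
  have s: "s \<in> \<nu> \<rightarrow>\<^sub>M count_space I"
    using s_range s_vimage_sets by (auto simp: measurable_count_space_eq2[OF I(1)])
  define w where "w k = prob (s -` {k} \<inter> space \<nu>)" for k
  have w_sum: "(\<Sum>k\<in>I. w k) = 1"
  proof -
    have "prob (\<Union>k\<in>I. s -` {k} \<inter> space \<nu>) = (\<Sum>k\<in>I. w k)"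
      unfolding w_def using I s_vimage_sets
      by (intro finite_measure_finite_Union) (auto simp: disjoint_family_on_def)
    moreover have "(\<Union>k\<in>I. s -` {k} \<inter> space \<nu>) = space \<nu>" using s_range by auto
    ultimately show ?thesis by (simp add: prob_space)
  qed
  define N1 where "N1 = {z \<in> space (\<nu> \<Otimes>\<^sub>M \<nu>). 1 < case_prod (dendron_dist T) z}"
  have N1: "N1 \<in> sets (\<nu> \<Otimes>\<^sub>M \<nu>)"
    unfolding N1_def using measurable_dendron_dist by (intro borel_measurable_less borel_measurable_const)
  have N1_eq: "N1 = {(x, y). x \<in> mspace T \<times> {0..} \<and> y \<in> mspace T \<times> {0..} \<and> dendron_dist T x y > 1}"
    unfolding N1_def space_pair_measure space_\<nu> by auto
  then have N1_null: "emeasure (\<nu> \<Otimes>\<^sub>M \<nu>) N1 = 0" using null by simp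
  define D where "D k l = dendron_dist T (p k) (p l)" for k l
  have p_in: "fst (p k) \<in> X" "0 \<le> snd (p k)" if "k \<in> I" for k
    using Ep that by (auto simp: space_\<nu>)
  have D_eq: "D k l = d (fst (p k)) (fst (p l)) + snd (p k) + snd (p l)" for k l
    by (simp add: D_def dendron_dist_def split_beta)
  have close: "\<bar>dendron_dist T x y - D k l\<bar> \<le> 4 * \<epsilon>" if "k \<in> I" "l \<in> I" "x \<in> E k" "y \<in> E l" for x y k l
    unfolding D_def using that near Ep E_space by (intro dendron_dist_perturb) blast+
  \<comment> \<open>The product of two pieces has positive measure, also for \<open>k = l\<close>,
    so it contains a pair outside the null set \<open>N1\<close>; passing to the representatives
    costs \<open>4 * \<epsilon>\<close>.\<close>
  have D_le: "D k l \<le> 1 + 4 * \<epsilon>" if kl: "k \<in> I" "l \<in> I" for k l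
  proof -
    have sub: "E k \<times> E l \<in> sets (\<nu> \<Otimes>\<^sub>M \<nu>)" using Ep kl by auto
    have "emeasure (\<nu> \<Otimes>\<^sub>M \<nu>) (E k \<times> E l) = emeasure \<nu> (E k) * emeasure \<nu> (E l)"
      using Ep kl by (intro emeasure_pair_measure_Times) auto
    also have "\<dots> \<noteq> 0" using Ep kl by force
    finally have "\<not> E k \<times> E l \<subseteq> N1" using emeasure_mono[OF _ N1, of "E k \<times> E l"] N1_null by auto
    then obtain x y where xy: "x \<in> E k" "y \<in> E l" "(x, y) \<notin> N1" by blast
    then have "dendron_dist T x y \<le> 1"
      using E_space kl by (auto simp: N1_def space_pair_measure not_less)
    then show ?thesis using close[OF kl xy(1,2)] by linarith
  qed
  have D_ge: "0 \<le> D k l" if "k \<in> I" "l \<in> I" for k l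
    using p_in[OF that(1)] p_in[OF that(2)] by (simp add: D_eq)
  interpret W: weighted_tree_metric I "\<lambda>k l. d (fst (p k)) (fst (p l))" "\<lambda>k. snd (p k)" w base "4 * \<epsilon>"
  proof
    show "finite I" "base \<in> I" by fact+
    fix k l m
    assume k: "k \<in> I"
    show "0 \<le> snd (p k)" using p_in[OF k] by simp
    show "0 \<le> w k" by (simp add: w_def)
    assume l: "l \<in> I"
    show "d (fst (p k)) (fst (p l)) = d (fst (p l)) (fst (p k))" by (rule commute)
    show "0 \<le> d (fst (p k)) (fst (p l))" by simp
    show "d (fst (p k)) (fst (p l)) + snd (p k) + snd (p l) \<le> 1 + 4 * \<epsilon>"
      using D_le[OF k l] by (simp add: D_eq)
    assume m: "m \<in> I"
    show "d (fst (p k)) (fst (p m)) \<le> d (fst (p k)) (fst (p l)) + d (fst (p l)) (fst (p m))"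
      using p_in k l m by (intro triangle)
    show "min ((d (fst (p base)) (fst (p k)) + d (fst (p base)) (fst (p l)) - d (fst (p k)) (fst (p l))) / 2)
        ((d (fst (p base)) (fst (p l)) + d (fst (p base)) (fst (p m)) - d (fst (p l)) (fst (p m))) / 2)
      \<le> (d (fst (p base)) (fst (p k)) + d (fst (p base)) (fst (p m)) - d (fst (p k)) (fst (p m))) / 2"
      using gromov_product_ultra[OF p_in(1)[OF base] p_in(1)[OF k] p_in(1)[OF l] p_in(1)[OF m]]
      by (simp only: gromov_product_def)
  qed (use w_sum \<epsilon> in auto)
  have cI: "1 \<le> real (card I)" using I by (simp add: Suc_le_eq card_gt_0_iff)
  \<comment> \<open>One tolerance for all \<open>r \<le> n\<close>: it beats the number of label
    words times the length of a word. \<open>Suc n\<close> keeps the denominator positive for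
    \<open>n = 0\<close>.\<close>
  define \<delta> where "\<delta> = \<epsilon> / (real (card I) ^ n * real (Suc n))"
  have den: "1 \<le> real (card I) ^ n * real (Suc n)"
    using mult_mono[OF one_le_power[OF cI, of n], of 1 "real (Suc n)"] by simp
  have \<delta>: "0 < \<delta>" using den \<epsilon> by (simp add: \<delta>_def)
  have \<delta>_le: "\<delta> \<le> \<epsilon>" using den \<epsilon> by (simp add: \<delta>_def divide_le_eq mult_le_cancel_left1)
  have \<delta>_small: "real (card I) ^ r * (real r * \<delta>) \<le> \<epsilon>" if r: "r \<le> n" for r
  proof -
    have "real (card I) ^ r * real r \<le> real (card I) ^ n * real (Suc n)"
      using r cI by (intro mult_mono power_increasing) auto
    then have "(real (card I) ^ r * real r) * \<delta> \<le> (real (card I) ^ n * real (Suc n)) * \<delta>"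
      using \<delta> by (intro mult_right_mono) auto
    also have "\<dots> = \<epsilon>" using cI by (auto simp: \<delta>_def)
    finally show ?thesis by (simp add: mult.assoc)
  qed
  obtain G :: "nat pair_pre_digraph" and t where G: "nontrivial_finite_tree G" and V: "finite (pverts G)"
    and t_I: "t \<in> pverts G \<rightarrow> I"
    and freq: "\<forall>l\<in>I. \<bar>real (card {v \<in> pverts G. t v = l}) / real (card (pverts G)) - w l\<bar> \<le> \<delta>"
    and bad: "real (card {(u, v) \<in> pverts G \<times> pverts G.
       \<not> \<bar>tree_dist G u v - (d (fst (p (t u))) (fst (p (t v))) + snd (p (t u)) + snd (p (t v)))\<bar> \<le> 3 * (4 * \<epsilon>)})
       \<le> \<delta> * real (card (pverts G)) ^ 2"
    and unit: "\<forall>u\<in>pverts G. \<forall>v\<in>pverts G. tree_dist G u v \<in> {0..1}"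
    by (rule W.tree_approximation[OF \<delta>])
  let ?V = "pverts G"
  let ?\<mu> = "uniform_count_measure ?V"
  have V0: "?V \<noteq> {}" using G by (auto simp: nontrivial_finite_tree_def)
  have \<mu>: "prob_space ?\<mu>" by (rule prob_space_uniform_count_measure[OF V V0])
  have t: "t \<in> ?\<mu> \<rightarrow>\<^sub>M count_space I"
    unfolding measurable_cong_sets[OF sets_uniform_count_measure_count_space refl] using t_I by simp
  define N2 where "N2 = (N0 \<times> space \<nu> \<union> space \<nu> \<times> N0) \<union> N1"
  interpret PP: pair_prob_space \<nu> \<nu> by unfold_locales
  have N2: "N2 \<in> sets (\<nu> \<Otimes>\<^sub>M \<nu>)" unfolding N2_def using N0 N1 by auto
  have N2_le: "measure (\<nu> \<Otimes>\<^sub>M \<nu>) N2 \<le> 2 * \<epsilon>"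
  proof -
    have "measure (\<nu> \<Otimes>\<^sub>M \<nu>) N2 \<le> measure (\<nu> \<Otimes>\<^sub>M \<nu>) (N0 \<times> space \<nu> \<union> space \<nu> \<times> N0) + measure (\<nu> \<Otimes>\<^sub>M \<nu>) N1"
      unfolding N2_def using N0 N1 by (intro measure_Un_le) auto
    also have "measure (\<nu> \<Otimes>\<^sub>M \<nu>) (N0 \<times> space \<nu> \<union> space \<nu> \<times> N0)
       \<le> measure (\<nu> \<Otimes>\<^sub>M \<nu>) (N0 \<times> space \<nu>) + measure (\<nu> \<Otimes>\<^sub>M \<nu>) (space \<nu> \<times> N0)"
      using N0 by (intro measure_Un_le) auto
    also have "measure (\<nu> \<Otimes>\<^sub>M \<nu>) (N0 \<times> space \<nu>) = prob N0"
      using N0 by (simp add: measure_def emeasure_pair_measure_Times emeasure_space_1)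
    also have "measure (\<nu> \<Otimes>\<^sub>M \<nu>) (space \<nu> \<times> N0) = prob N0"
      using N0 by (simp add: measure_def emeasure_pair_measure_Times emeasure_space_1)
    also have "measure (\<nu> \<Otimes>\<^sub>M \<nu>) N1 = 0" using N1_null by (simp add: measure_def)
    finally show ?thesis using rest by (simp add: N0_def)
  qed
  \<comment> \<open>Origin of the cube of side 2: representatives may exceed distance 1 by
    \<open>4 * \<epsilon> \<le> 1\<close>.\<close>
  have D2: "D k l \<in> {0..2}" if "k \<in> I" "l \<in> I" for k l
    using D_le[OF that] D_ge[OF that] \<epsilon> by auto
  define N3 where "N3 = {(u, v) \<in> ?V \<times> ?V. \<not> \<bar>tree_dist G u v - D (t u) (t v)\<bar> \<le> 12 * \<epsilon>}"
  have N3: "N3 \<in> sets (?\<mu> \<Otimes>\<^sub>M ?\<mu>)"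
    unfolding pair_uniform_count_measure[OF V V0] sets_uniform_count_measure by (auto simp: N3_def)
  have N3_le: "measure (?\<mu> \<Otimes>\<^sub>M ?\<mu>) N3 \<le> \<epsilon>"
  proof -
    have "measure (?\<mu> \<Otimes>\<^sub>M ?\<mu>) N3 = real (card N3) / real (card (?V \<times> ?V))"
      unfolding pair_uniform_count_measure[OF V V0]
      using V by (intro measure_uniform_count_measure) (auto simp: N3_def)
    also have "\<dots> \<le> \<delta>"
    proof -
      have "0 < real (card ?V)" using V V0 by (simp add: card_gt_0_iff)
      moreover have "real (card N3) \<le> \<delta> * real (card ?V) ^ 2"
        using bad unfolding N3_def D_eq by (simp add: mult.assoc[symmetric])
      ultimately show ?thesis by (simp add: card_cartesian_product divide_le_eq power2_eq_square)
    qed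
    finally show ?thesis using \<delta>_le by simp
  qed
  show ?thesis
  proof (intro exI[of _ G] conjI allI impI)
    fix r f B \<eta>
    assume "r \<le> n \<and> continuous_map (matrix_space r) euclideanreal f \<and>
        (\<forall>A\<in>topspace (matrix_space r). \<bar>f A\<bar> \<le> B) \<and> 0 \<le> \<eta> \<and> matrix_modulus r f 2 (12 * \<epsilon>) \<eta>"
    then have r: "r \<le> n" and f: "continuous_map (matrix_space r) euclideanreal f"
      and fB: "\<And>A. A \<in> topspace (matrix_space r) \<Longrightarrow> \<bar>f A\<bar> \<le> B"
      and \<eta>: "0 \<le> \<eta>" and mod: "matrix_modulus r f 2 (12 * \<epsilon>) \<eta>" by simp_all
    have B: "0 \<le> B" using fB[OF distance_matrix_in_topspace] by (meson abs_ge_zero order_trans)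
    have "\<bar>(\<integral>A. f A \<partial>sampling_measure r (dendron_dist T) \<nu>)
        - (\<integral>A. f A \<partial>sampling_measure r (\<lambda>x y. D (s x) (s y)) \<nu>)\<bar> \<le> \<eta> + 2 * B * real r ^ 2 * (2 * \<epsilon>)"
    proof (rule sampling_measure_close[OF prob_space_axioms measurable_dendron_dist
          measurable_pushforward_dist[OF s I(1)] f fB mod _ _ \<eta> N2 N2_le])
      fix x y assume xy: "x \<in> space \<nu>" "y \<in> space \<nu>" "(x, y) \<notin> N2"
      then have n: "x \<notin> N0" "y \<notin> N0" "(x, y) \<notin> N1" by (auto simp: N2_def)
      have "dendron_dist T x y \<le> 1" using n(3) xy by (simp add: N1_def space_pair_measure)
      moreover have "0 \<le> dendron_dist T x y"
        using xy by (auto simp: space_\<nu> dendron_dist_def)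
      moreover have "\<bar>dendron_dist T x y - D (s x) (s y)\<bar> \<le> 4 * \<epsilon>"
        using s_I xy n by (intro close) auto
      ultimately show "dendron_dist T x y \<in> {0..2} \<and> D (s x) (s y) \<in> {0..2} \<and>
          \<bar>dendron_dist T x y - D (s x) (s y)\<bar> \<le> 12 * \<epsilon>"
        using D2[OF s_range[OF xy(1)] s_range[OF xy(2)]] \<epsilon> by auto
    qed (use \<epsilon> in auto)
    moreover have "\<bar>(\<integral>A. f A \<partial>sampling_measure r (\<lambda>x y. D (s x) (s y)) \<nu>)
        - (\<integral>A. f A \<partial>sampling_measure r (\<lambda>x y. D (t x) (t y)) ?\<mu>)\<bar> \<le> B * real (card I) ^ r * (real r * \<delta>)"
    proof (rule sampling_measure_finite_close[OF prob_space_axioms \<mu> s t I(1) f fB])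
      fix l assume l: "l \<in> I"
      have "t -` {l} \<inter> space ?\<mu> = {v \<in> ?V. t v = l}" by (auto simp: space_uniform_count_measure)
      then have "measure ?\<mu> (t -` {l} \<inter> space ?\<mu>) = real (card {v \<in> ?V. t v = l}) / real (card ?V)"
        using V by (simp add: measure_uniform_count_measure)
      then show "\<bar>prob (s -` {l} \<inter> space \<nu>) - measure ?\<mu> (t -` {l} \<inter> space ?\<mu>)\<bar> \<le> \<delta>"
        using freq l by (simp add: w_def abs_minus_commute)
    qed
    moreover have "\<bar>(\<integral>A. f A \<partial>sampling_measure r (tree_dist G) ?\<mu>)
        - (\<integral>A. f A \<partial>sampling_measure r (\<lambda>x y. D (t x) (t y)) ?\<mu>)\<bar> \<le> \<eta> + 2 * B * real r ^ 2 * \<epsilon>"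
    proof (rule sampling_measure_close[OF \<mu> measurable_uniform_count_pair[OF V V0]
          measurable_pushforward_dist[OF t I(1)] f fB mod _ _ \<eta> N3 N3_le])
      fix u v assume "u \<in> space ?\<mu>" "v \<in> space ?\<mu>" "(u, v) \<notin> N3"
      then have uv: "u \<in> ?V" "v \<in> ?V" "\<bar>tree_dist G u v - D (t u) (t v)\<bar> \<le> 12 * \<epsilon>"
        by (auto simp: N3_def space_uniform_count_measure)
      moreover have "tree_dist G u v \<in> {0..1}" using unit uv by blast
      moreover have "D (t u) (t v) \<in> {0..2}" using t_I uv by (intro D2) auto
      ultimately show "tree_dist G u v \<in> {0..2} \<and> D (t u) (t v) \<in> {0..2} \<and>
          \<bar>tree_dist G u v - D (t u) (t v)\<bar> \<le> 12 * \<epsilon>" by auto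
    qed (use \<epsilon> in auto)
    moreover have "B * real (card I) ^ r * (real r * \<delta>) \<le> B * \<epsilon>"
      using mult_left_mono[OF \<delta>_small[OF r] B] by (simp add: mult.assoc)
    ultimately have "\<bar>(\<integral>A. f A \<partial>sampling_measure r (tree_dist G) ?\<mu>)
        - (\<integral>A. f A \<partial>sampling_measure r (dendron_dist T) \<nu>)\<bar>
        \<le> (\<eta> + 2 * B * real r ^ 2 * (2 * \<epsilon>)) + B * \<epsilon> + (\<eta> + 2 * B * real r ^ 2 * \<epsilon>)" by linarith
    also have "\<dots> = 2 * \<eta> + (6 * real r ^ 2 + 1) * B * \<epsilon>" by (simp add: algebra_simps)
    finally show "\<bar>(\<integral>A. f A \<partial>tree_sampling_measure r G) - (\<integral>A. f A \<partial>dendron_sampling_measure r T \<nu>)\<bar>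
          \<le> 2 * \<eta> + (6 * real r ^ 2 + 1) * B * \<epsilon>"
      by (simp add: tree_sampling_measure_def dendron_sampling_measure_def)
  qed (fact G V)+
qed

end

section \<open>Convergence along the sequence of trees\<close>

lemma matrix_modulus_antimono: "matrix_modulus r f C \<delta> \<eta> \<Longrightarrow> \<delta>' \<le> \<delta> \<Longrightarrow> matrix_modulus r f C \<delta>' \<eta>"
  unfolding matrix_modulus_def by (meson order_trans)

theorem theorem2:
  fixes T :: "'a metric" and \<nu> :: "('a \<times> real) measure"
  assumes "dendron T \<nu>"
  shows "\<exists>Ts :: nat \<Rightarrow> nat pair_pre_digraph.
           (\<forall>n. nontrivial_finite_tree (Ts n)) \<and>
           convergent_in_metric_sampling Ts \<and>
           (\<forall>r\<ge>1. weakly_converges (matrix_space r)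
              (\<lambda>n. tree_sampling_measure r (Ts n)) (dendron_sampling_measure r T \<nu>))"
proof -
  interpret long_dendron_space T \<nu>
    using assms by unfold_locales (simp add: dendron_def)
  define \<epsilon> where "\<epsilon> n = 1 / (4 * real (Suc n))" for n
  have \<epsilon>: "0 < \<epsilon> n" "4 * \<epsilon> n \<le> 1" for n by (auto simp: \<epsilon>_def)
  have \<epsilon>_lim: "(\<lambda>n. c * \<epsilon> n) \<longlonglongrightarrow> 0" for c
  proof -
    have "(\<lambda>n. (c / 4) * inverse (real (Suc n))) \<longlonglongrightarrow> (c / 4) * 0"
      by (intro tendsto_mult tendsto_const LIMSEQ_inverse_real_of_nat)
    then show ?thesis by (simp add: \<epsilon>_def divide_simps)
  qed
  \<comment> \<open>The condition \<open>r \<le> n\<close> lets the \<open>n\<close>-th tree handle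
    finitely many sizes at once, and every size from some index on.\<close>
  define close where "close n G \<longleftrightarrow> (\<forall>r f B \<eta>. r \<le> n \<and> continuous_map (matrix_space r) euclideanreal f \<and>
        (\<forall>A\<in>topspace (matrix_space r). \<bar>f A\<bar> \<le> B) \<and> 0 \<le> \<eta> \<and> matrix_modulus r f 2 (12 * \<epsilon> n) \<eta> \<longrightarrow>
        \<bar>(\<integral>A. f A \<partial>tree_sampling_measure r G) - (\<integral>A. f A \<partial>dendron_sampling_measure r T \<nu>)\<bar>
          \<le> 2 * \<eta> + (6 * real r ^ 2 + 1) * B * \<epsilon> n)" for n and G :: "nat pair_pre_digraph"
  have "\<forall>n. \<exists>G :: nat pair_pre_digraph. nontrivial_finite_tree G \<and> finite (pverts G) \<and> close n G"
    unfolding close_def using assms \<epsilon> by (intro allI ex_tree_approximation) (auto simp: dendron_def)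
  then obtain Ts :: "nat \<Rightarrow> nat pair_pre_digraph" where Ts: "\<And>n. nontrivial_finite_tree (Ts n)"
    "\<And>n. finite (pverts (Ts n))" "\<And>n. close n (Ts n)" by metis
  have weak: "weakly_converges (matrix_space r) (\<lambda>n. tree_sampling_measure r (Ts n))
      (dendron_sampling_measure r T \<nu>)" for r
    unfolding weakly_converges_def
  proof (intro conjI allI impI)
    have "tree_sampling_measure r (Ts n) \<in> Prob (matrix_space r)" for n
    proof -
      have "pverts (Ts n) \<noteq> {}" using Ts(1)[of n] by (auto simp: nontrivial_finite_tree_def)
      then show ?thesis
        unfolding tree_sampling_measure_def using Ts(2)[of n]
        by (intro sampling_measure_in_Prob prob_space_uniform_count_measure measurable_uniform_count_pair)
    qed
    then show "range (\<lambda>n. tree_sampling_measure r (Ts n)) \<subseteq> Prob (matrix_space r)" by auto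
    show "dendron_sampling_measure r T \<nu> \<in> Prob (matrix_space r)"
      unfolding dendron_sampling_measure_def
      by (intro sampling_measure_in_Prob prob_space_axioms measurable_dendron_dist)
  next
    fix f assume *: "continuous_map (matrix_space r) euclideanreal f \<and> bounded (f ` topspace (matrix_space r))"
    then obtain B where B: "\<forall>A\<in>topspace (matrix_space r). \<bar>f A\<bar> \<le> B" by (auto simp: bounded_iff)
    show "(\<lambda>n. \<integral>A. f A \<partial>tree_sampling_measure r (Ts n)) \<longlonglongrightarrow> (\<integral>A. f A \<partial>dendron_sampling_measure r T \<nu>)"
    proof (rule tendstoI)
      fix e :: real assume e: "0 < e"
      \<comment> \<open>The modulus enters the estimate twice, so \<open>e / 4\<close> uses up half
        of \<open>e\<close>; the term with \<open>B\<close> gets the other half.\<close>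
      obtain \<delta> where \<delta>: "\<delta> > 0" "matrix_modulus r f 2 \<delta> (e / 4)"
        using continuous_imp_matrix_modulus[of r f "e / 4" 2] * e by auto
      have "\<forall>\<^sub>F n in sequentially. 12 * \<epsilon> n < \<delta>"
        using \<epsilon>_lim \<delta>(1) by (rule order_tendstoD)
      moreover have "\<forall>\<^sub>F n in sequentially. (6 * real r ^ 2 + 1) * B * \<epsilon> n < e / 2"
        using \<epsilon>_lim by (rule order_tendstoD) (use e in simp)
      moreover have "\<forall>\<^sub>F n in sequentially. r \<le> n" by (rule eventually_ge_at_top)
      ultimately show "\<forall>\<^sub>F n in sequentially. dist (\<integral>A. f A \<partial>tree_sampling_measure r (Ts n))
          (\<integral>A. f A \<partial>dendron_sampling_measure r T \<nu>) < e"
      proof eventually_elim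
        case (elim n)
        have "matrix_modulus r f 2 (12 * \<epsilon> n) (e / 4)"
          using matrix_modulus_antimono[OF \<delta>(2)] elim(1) by simp
        then have "\<bar>(\<integral>A. f A \<partial>tree_sampling_measure r (Ts n)) - (\<integral>A. f A \<partial>dendron_sampling_measure r T \<nu>)\<bar>
            \<le> 2 * (e / 4) + (6 * real r ^ 2 + 1) * B * \<epsilon> n"
          using * B e elim(3) by (intro Ts(3)[of n, unfolded close_def, rule_format] conjI) auto
        then show ?case using elim(2) by (simp add: dist_real_def)
      qed
    qed
  qed
  then have "convergent_in_metric_sampling Ts"
    unfolding convergent_in_metric_sampling_def by blast
  then show ?thesis using Ts(1) weak by blast
qed

end
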